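(* In the setting fixed in the context, suppose the structural condition (A) holds with constants $\tau,\sigma>0$, and suppose the density $\rho$ satisfies $\underline\rho\le\rho(s)\le\overline\rho$ for all $s\in(0,\alpha)$ with positive numbers $\underline\rho,\overline\rho$. Let $0<\mu<\bar\mu_1$, where $$\bar\mu_1=\min\Big\{\frac{\tau}{\alpha},\frac{\lambda\sigma\underline\rho}{L_{c,1}}\Big\},\qquad \lambda=\min\{\lambda_1,\lambda_2\}.$$ Consider the problems $(\mathrm{P})$: $\min_{x\in X}\max_{y\in Y}f(x,y)$ and $(\mathrm{P}_\mu)$: $\min_{x\in X}\max_{y\in Y}f^R(x,y,\mu)$. Then: (i) $(x^*,y^* )$ is a saddle point (respectively, global minimax point) of $(\mathrm{P})$ if and only if it is a saddle point (respectively, global minimax point) of $(\mathrm{P}_\mu)$; (ii) $(x^*,y^* )$ is an $\alpha\mu$-strong local saddle point (respectively, local minimax point) of $(\mathrm{P})$ if it is a local saddle point (respectively, local minimax point) of $(\mathrm{P}_\mu)$.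
   Context: Notation. $[k]=\{1,\dots,k\}$; $\mathbf{B}(z,\delta)$ is the closed ball with center $z$ and radius $\delta$; $(t_+)^0=1$ if $t>0$ and $(t_+)^0=0$ if $t\le0$; $\partial$ is the Clarke subdifferential ($\partial_x c(\bar x,\bar y)$ is that of $c(\cdot,\bar y)$ at $\bar x$, $\partial_y c(\bar x,\bar y)$ that of $c(\bar x,\cdot)$ at $\bar y$); for a set $S$, $\|S\|_\infty=\sup_{s\in S}\|s\|_\infty$. Data. $c:\mathbb{R}^n\times\mathbb{R}^m\to\mathbb{R}$ is Lipschitz continuous, convex in $x$ for each $y$ and concave in $y$ for each $x$; $g_1,\dots,g_{2n},h_1,\dots,h_{2m}:\mathbb{R}\to\mathbb{R}$ are continuously differentiable; $\lambda_1,\lambda_2>0$. $X=\tilde X\cap\bar X$ and $Y=\tilde Y\cap\bar Y$ have nonempty interior, where $\tilde X=\{x\in\mathbb{R}^n:\underline{\mathbf u}\le x\le\overline{\mathbf u}\}$, $\tilde Y=\{y\in\mathbb{R}^m:\underline{\mathbf v}\le y\le\overline{\mathbf v}\}$ with $\underline{\mathbf u}<\overline{\mathbf u}$, $\underline{\mathbf v}<\overline{\mathbf v}$ (componentwise), and $\bar X=\{x:u_t(x)\le0,\ t\in[\bar n]\}$, $\bar Y=\{y:v_s(y)\le0,\ s\in[\bar m]\}$ with Lipschitz continuous convex functions $u_t:\mathbb{R}^n\to\mathbb{R}$, $v_s:\mathbb{R}^m\to\mathbb{R}$. Put $\tilde X_i=[\underline{\mathbf u}_i,\overline{\mathbf u}_i]$,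 $\tilde Y_j=[\underline{\mathbf v}_j,\overline{\mathbf v}_j]$, $\mathcal{T}_0(x)=\{t:u_t(x)=0\}$, $\mathcal{S}_0(y)=\{s:v_s(y)=0\}$. $L_{c,1}>0$ is a constant with $\|\partial_x c(x,y)\|_\infty\le L_{c,1}$ and $\|\partial_y c(x,y)\|_\infty\le L_{c,1}$ for all $(x,y)\in X\times Y$. The objective is $$f(x,y)=c(x,y)+\lambda_1\sum_{i=1}^n\big((g_i(x_i)_+)^0+(g_{n+i}(x_i)_+)^0\big)-\lambda_2\sum_{j=1}^m\big((h_j(y_j)_+)^0+(h_{m+j}(y_j)_+)^0\big).$$ Structural condition (A) with constants $\tau,\sigma>0$: (i) for any $x\in X$, $i\in[n]$ and $(\hat i,\check i)\in\{(i,n+i),(n+i,i)\}$, if $g_{\hat i}(x_i)\in(0,\tau)$ then $x_i\in\mathrm{int}(\tilde X_i)$, $g_{\check i}(x_i)\notin[0,\tau]$, $|g_{\hat i}'(x_i)|\ge\sigma$, and $\xi_i\,g_{\hat i}'(x_i)\ge0$ for all $\xi\in\partial u_t(x)$, $t\in\mathcal{T}_0(x)$; (ii) for any $y\in Y$, $j\in[m]$ and $(\hat j,\check j)\in\{(j,m+j),(m+j,j)\}$, if $h_{\hat j}(y_j)\in(0,\tau)$ then $y_j\in\mathrm{int}(\tilde Y_j)$, $h_{\check j}(y_j)\notin[0,\tau]$, $|h_{\hat j}'(y_j)|\ge\sigma$, and $\eta_j\,h_{\hat j}'(y_j)\ge0$ for all $\eta\in\partial v_s(y)$, $s\in\mathcal{S}_0(y)$.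 Relaxation. $\rho:\mathbb{R}\to[0,+\infty)$ is a piecewise continuous density function (integral $1$) with $\rho(s)=0$ for $s\notin[0,\alpha]$, $\alpha>0$; $r(t,\mu)=\int_{-\infty}^{t/\mu}\rho(s)\,ds$. For $\mu>0$, $$f^R(x,y,\mu)=c(x,y)+\lambda_1\sum_{i=1}^n\big(r(g_i(x_i),\mu)+r(g_{n+i}(x_i),\mu)\big)-\lambda_2\sum_{j=1}^m\big(r(h_j(y_j),\mu)+r(h_{m+j}(y_j),\mu)\big).$$ Solution concepts for $\min_{x\in X}\max_{y\in Y}F(x,y)$, at $(x^*,y^* )\in X\times Y$. Saddle point: $F(x^*,y)\le F(x^*,y^* )\le F(x,y^* )$ for all $(x,y)\in X\times Y$. Local saddle point: there is $\delta>0$ such that these inequalities hold for all $x\in X\cap\mathbf{B}(x^*,\delta)$, $y\in Y\cap\mathbf{B}(y^*,\delta)$. Global minimax point: $F(x^*,y)\le F(x^*,y^* )\le\max_{y'\in Y}F(x,y')$ for all $(x,y)\in X\times Y$. Local minimax point: there exist $\delta_0>0$ and $\pi:[0,+\infty)\to[0,+\infty)$ with $\pi(\delta)\to0$ as $\delta\to0$ such that for any $\delta\in(0,\delta_0]$, $x\in X\cap\mathbf{B}(x^*,\delta)$ and $y\in Y\cap\mathbf{B}(y^*,\delta)$, $F(x^*,y)\le F(x^*,y^* )\le\max_{y'\in Y\cap\mathbf{B}(y^*,\pi(\delta))}F(x,y')$. For $\nu>0$, a $\nu$-strong local saddle point of $(\mathrm{P})$ is a local saddle point $(x^*,y^* )$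 of $(\mathrm{P})$ with $g_i(x^*_i),g_{n+i}(x^*_i)\notin(0,\nu)$ for all $i\in[n]$ and $h_j(y^*_j),h_{m+j}(y^*_j)\notin(0,\nu)$ for all $j\in[m]$.
   Formalization: The formal theorem additionally assumes that each constraint function u_t and each v_s is negative somewhere (with nonempty interior of X and Y this is Slater's condition); without it the claim fails, since active subgradients may all vanish on the boundary of X. *)

theory Defs
  imports "HOL-Analysis.Analysis"
begin

(* Clarke's generalized directional derivative limsup_{y -> x, t -> 0+} (f(y + t v) - f(y)) / t;
   it is taken in ereal, so it is meaningful without assuming f locally Lipschitz. *)
definition clarke_dir_deriv :: "('a::real_normed_vector \<Rightarrow> real) \<Rightarrow> 'a \<Rightarrow> 'a \<Rightarrow> ereal" where
  "clarke_dir_deriv f x v =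
     Limsup (nhds x \<times>\<^sub>F at_right 0) (\<lambda>(y, t). ereal ((f (y + t *\<^sub>R v) - f y) / t))"

definition clarke_subdiff :: "('a::real_inner \<Rightarrow> real) \<Rightarrow> 'a \<Rightarrow> 'a set" where
  "clarke_subdiff f x = {\<xi>. \<forall>v. ereal (\<xi> \<bullet> v) \<le> clarke_dir_deriv f x v}"

(* infnorm is the library's max-norm of a vector *)
definition set_infnorm :: "'a::euclidean_space set \<Rightarrow> ereal" where
  "set_infnorm S = (SUP s\<in>S. ereal (infnorm s))"

(* cbox lo hi is the box {x. lo $ i \<le> x $ i \<le> hi $ i for all i}; the constraint functions are
   w 1, ..., w k; k = 0 (box only) is allowed *)
definition feasible_set ::
  "real^'d \<Rightarrow> real^'d \<Rightarrow> nat \<Rightarrow> (nat \<Rightarrow> real^'d \<Rightarrow> real) \<Rightarrow> (real^'d) set" where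
  "feasible_set lo hi k w = cbox lo hi \<inter> {x. \<forall>t\<in>{1..k}. w t x \<le> 0}"

definition active_set :: "nat \<Rightarrow> (nat \<Rightarrow> real^'d \<Rightarrow> real) \<Rightarrow> real^'d \<Rightarrow> nat set" where
  "active_set k w x = {t\<in>{1..k}. w t x = 0}"

(* (t_+)^0 *)
definition pos_zero_power :: "real \<Rightarrow> real" where
  "pos_zero_power t = (if t > 0 then 1 else 0)"

(* A family of 2d functions g_1, ..., g_{2d} is indexed by 'd + 'd:
   Inl i stands for the index i and Inr i for the index d + i. *)
definition objective ::
  "(real^'n \<Rightarrow> real^'m \<Rightarrow> real) \<Rightarrow> real \<Rightarrow> real \<Rightarrow> ('n + 'n \<Rightarrow> real \<Rightarrow> real) \<Rightarrow>
   ('m + 'm \<Rightarrow> real \<Rightarrow> real) \<Rightarrow> real^'n \<Rightarrow> real^'m \<Rightarrow> real" where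
  "objective c lam1 lam2 g h x y =
     c x y
     + lam1 * (\<Sum>i\<in>UNIV. pos_zero_power (g (Inl i) (x $ i)) + pos_zero_power (g (Inr i) (x $ i)))
     - lam2 * (\<Sum>j\<in>UNIV. pos_zero_power (h (Inl j) (y $ j)) + pos_zero_power (h (Inr j) (y $ j)))"

definition smoothed_step :: "(real \<Rightarrow> real) \<Rightarrow> real \<Rightarrow> real \<Rightarrow> real" where
  "smoothed_step \<rho> t \<mu> = integral {..t / \<mu>} \<rho>"

definition relaxed_objective ::
  "(real^'n \<Rightarrow> real^'m \<Rightarrow> real) \<Rightarrow> real \<Rightarrow> real \<Rightarrow> ('n + 'n \<Rightarrow> real \<Rightarrow> real) \<Rightarrow>
   ('m + 'm \<Rightarrow> real \<Rightarrow> real) \<Rightarrow> (real \<Rightarrow> real) \<Rightarrow> real \<Rightarrow> real^'n \<Rightarrow> real^'m \<Rightarrow> real" where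
  "relaxed_objective c lam1 lam2 g h \<rho> \<mu> x y =
     c x y
     + lam1 * (\<Sum>i\<in>UNIV. smoothed_step \<rho> (g (Inl i) (x $ i)) \<mu>
                       + smoothed_step \<rho> (g (Inr i) (x $ i)) \<mu>)
     - lam2 * (\<Sum>j\<in>UNIV. smoothed_step \<rho> (h (Inl j) (y $ j)) \<mu>
                       + smoothed_step \<rho> (h (Inr j) (y $ j)) \<mu>)"

(* Finitely many discontinuities, all with finite one-sided limits. *)
definition piecewise_continuous :: "(real \<Rightarrow> real) \<Rightarrow> bool" where
  "piecewise_continuous \<rho> \<longleftrightarrow>
     (\<exists>D. finite D \<and> (\<forall>s. s \<notin> D \<longrightarrow> isCont \<rho> s) \<and>
          (\<forall>s\<in>D. (\<exists>l. (\<rho> \<longlongrightarrow> l) (at_left s)) \<and> (\<exists>l. (\<rho> \<longlongrightarrow> l) (at_right s))))"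

(* The condition has the same form for x and for y, so it is stated once,
   for the feasible set given by lo, hi, k, w and the family g. *)
definition structural_condition ::
  "real^'d \<Rightarrow> real^'d \<Rightarrow> nat \<Rightarrow> (nat \<Rightarrow> real^'d \<Rightarrow> real) \<Rightarrow> ('d + 'd \<Rightarrow> real \<Rightarrow> real) \<Rightarrow>
   real \<Rightarrow> real \<Rightarrow> bool" where
  "structural_condition lo hi k w g \<tau> \<sigma> \<longleftrightarrow>
     (\<forall>x\<in>feasible_set lo hi k w. \<forall>i. \<forall>(p, q)\<in>{(Inl i, Inr i), (Inr i, Inl i)}.
        g p (x $ i) \<in> {0<..<\<tau>} \<longrightarrow>
          x $ i \<in> interior {lo $ i..hi $ i} \<and>
          g q (x $ i) \<notin> {0..\<tau>} \<and>
          \<bar>deriv (g p) (x $ i)\<bar> \<ge> \<sigma> \<and>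
          (\<forall>t\<in>active_set k w x. \<forall>\<xi>\<in>clarke_subdiff (w t) x. \<xi> $ i * deriv (g p) (x $ i) \<ge> 0))"

(* M is the maximum of \<phi> over S; attainment is part of the notion. *)
definition is_maximum :: "('a \<Rightarrow> real) \<Rightarrow> 'a set \<Rightarrow> real \<Rightarrow> bool" where
  "is_maximum \<phi> S M \<longleftrightarrow> M \<in> \<phi> ` S \<and> (\<forall>z\<in>S. \<phi> z \<le> M)"

definition saddle_point ::
  "'a set \<Rightarrow> 'b set \<Rightarrow> ('a \<Rightarrow> 'b \<Rightarrow> real) \<Rightarrow> 'a \<Rightarrow> 'b \<Rightarrow> bool" where
  "saddle_point X Y F xs ys \<longleftrightarrow>
     xs \<in> X \<and> ys \<in> Y \<and> (\<forall>x\<in>X. \<forall>y\<in>Y. F xs y \<le> F xs ys \<and> F xs ys \<le> F x ys)"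

definition local_saddle_point ::
  "'a::metric_space set \<Rightarrow> 'b::metric_space set \<Rightarrow> ('a \<Rightarrow> 'b \<Rightarrow> real) \<Rightarrow> 'a \<Rightarrow> 'b \<Rightarrow> bool" where
  "local_saddle_point X Y F xs ys \<longleftrightarrow>
     xs \<in> X \<and> ys \<in> Y \<and>
     (\<exists>\<delta>>0. \<forall>x\<in>X \<inter> cball xs \<delta>. \<forall>y\<in>Y \<inter> cball ys \<delta>. F xs y \<le> F xs ys \<and> F xs ys \<le> F x ys)"

definition global_minimax_point ::
  "'a set \<Rightarrow> 'b set \<Rightarrow> ('a \<Rightarrow> 'b \<Rightarrow> real) \<Rightarrow> 'a \<Rightarrow> 'b \<Rightarrow> bool" where
  "global_minimax_point X Y F xs ys \<longleftrightarrow>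
     xs \<in> X \<and> ys \<in> Y \<and>
     (\<forall>x\<in>X. \<forall>y\<in>Y. F xs y \<le> F xs ys \<and> (\<exists>M. is_maximum (F x) Y M \<and> F xs ys \<le> M))"

(* \<pi> is a function on [0, \<infinity>), so only its values at nonnegative arguments are constrained. *)
definition local_minimax_point ::
  "'a::metric_space set \<Rightarrow> 'b::metric_space set \<Rightarrow> ('a \<Rightarrow> 'b \<Rightarrow> real) \<Rightarrow> 'a \<Rightarrow> 'b \<Rightarrow> bool" where
  "local_minimax_point X Y F xs ys \<longleftrightarrow>
     xs \<in> X \<and> ys \<in> Y \<and>
     (\<exists>\<delta>\<^sub>0>0. \<exists>\<pi> :: real \<Rightarrow> real.
        (\<forall>\<delta>\<ge>0. \<pi> \<delta> \<ge> 0) \<and> (\<pi> \<longlongrightarrow> 0) (at_right 0) \<and>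
        (\<forall>\<delta>\<in>{0<..\<delta>\<^sub>0}. \<forall>x\<in>X \<inter> cball xs \<delta>. \<forall>y\<in>Y \<inter> cball ys \<delta>.
           F xs y \<le> F xs ys \<and>
           (\<exists>M. is_maximum (F x) (Y \<inter> cball ys (\<pi> \<delta>)) M \<and> F xs ys \<le> M)))"

definition strong_local_saddle_point ::
  "real \<Rightarrow> (real^'n) set \<Rightarrow> (real^'m) set \<Rightarrow> (real^'n \<Rightarrow> real^'m \<Rightarrow> real) \<Rightarrow>
   ('n + 'n \<Rightarrow> real \<Rightarrow> real) \<Rightarrow> ('m + 'm \<Rightarrow> real \<Rightarrow> real) \<Rightarrow> real^'n \<Rightarrow> real^'m \<Rightarrow> bool" where
  "strong_local_saddle_point \<nu> X Y F g h xs ys \<longleftrightarrow>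
     local_saddle_point X Y F xs ys \<and>
     (\<forall>i. g (Inl i) (xs $ i) \<notin> {0<..<\<nu>} \<and> g (Inr i) (xs $ i) \<notin> {0<..<\<nu>}) \<and>
     (\<forall>j. h (Inl j) (ys $ j) \<notin> {0<..<\<nu>} \<and> h (Inr j) (ys $ j) \<notin> {0<..<\<nu>})"

end

theory Submission
  imports Defs
begin

text \<open>
  Write both objectives as \<open>F x y = c x y + A x - B y\<close> and \<open>FR x y = c x y + AR x - BR y\<close>, where
  \<open>A\<close>, \<open>B\<close> are the weighted counts of positive constraint values and \<open>AR\<close>, \<open>BR\<close> their
  smoothed versions. The smoothed step lies below the step, and the two agree outside the band
  \<open>(0, \<alpha>\<mu>)\<close>. So \<open>AR \<le> A\<close>, with equality at points none of whose constraint values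
  lies in the band; likewise for \<open>BR\<close> and \<open>B\<close>.

  The heart of the matter is that local minimizers of a relaxed problem avoid the band
  (\<open>local_min_off_band\<close>). If some \<open>g p (x $ i)\<close> is in the band, moving \<open>x $ i\<close> so that \<open>g p\<close>
  decreases lowers \<open>AR\<close> at rate at least \<open>lam * \<sigma> * rlo / \<mu>\<close>, which by the choice of \<open>\<mu>\<close>
  exceeds the rate \<open>Lc\<close> at which \<open>c\<close> can grow. By the structural condition this direction is tangent to
  the feasible set, but a tangent direction need not be feasible (think of a ball). Hence it is tilted
  slightly towards a Slater point, which makes it feasible; the tilt disturbs the other smoothed steps
  only by a multiple of its size, because the density is bounded above.

  What the descent needs of \<open>c\<close> is a Lipschitz bound \<open>Lc\<close> in the \<open>l1\<close> distance, obtained from the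
  bound on Clarke subgradients by convexity in \<open>x\<close> and concavity in \<open>y\<close>. A Lipschitz bound passes to value functions \<open>x \<mapsto> max (c x y - BR y)\<close> and to penalized functions, so the
  same lemma applies to them. Everything else is comparison of \<open>A\<close> with \<open>AR\<close>. A relaxed minimizer avoids
  the band, hence is a minimizer of the larger original objective, which has the same value there.
  Conversely, some relaxed minimizer exists by compactness, and since it avoids the band the two minimal
  values coincide; so an original minimizer attains the relaxed minimum too. This gives the claims on saddle
  points, and, applied to the value function, those on global minimax points.

  Local minimax points need one more idea, because the inner maximizer \<open>yh\<close> over a small ball may sit on
  its sphere, inside the band. Maximizing \<open>c x y - BR y - \<kappa> * l1_dist yh y\<close> instead, with small
  \<open>\<kappa> > 0\<close>, gives a point outside the band that is at least as good as \<open>yh\<close>. It stays near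
  \<open>yh\<close>: the possible gain is bounded by a modulus \<open>\<omega>\<close> of \<open>FR\<close> in \<open>x\<close>, so its distance from \<open>yh\<close>
  is at most \<open>\<omega> \<delta> / \<kappa>\<close> (\<open>exact_ascent_point\<close>). The radius function
  \<open>\<pi> \<delta> + \<omega> \<delta> / \<kappa>\<close> then witnesses the local minimax property.
\<close>
section \<open>Subgradients of convex functions\<close>

text \<open>Separating the strict epigraph of \<open>f\<close> from a ray on or below the graph gives a subgradient that
  dominates the slope of that ray. With \<open>m = 0\<close> and \<open>d = 0\<close> this is the existence of subgradients;
  with a nonzero \<open>d\<close> it replaces the formula for directional derivatives as maxima over the
  subdifferential.\<close>

lemma convex_subgradient_along_ray:
  fixes f :: "'a::euclidean_space \<Rightarrow> real"
  assumes conv: "convex_on UNIV f"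
    and ray: "\<And>t. t \<ge> 0 \<Longrightarrow> f x + t * m \<le> f (x + t *\<^sub>R d)"
  obtains \<xi> where "\<And>z. f x + \<xi> \<bullet> (z - x) \<le> f z" and "m \<le> \<xi> \<bullet> d"
proof -
  define R where "R = (\<lambda>t. (x + t *\<^sub>R d, f x + t * m)) ` {0..}"
  define E where "E = {(z, s). f z < s}"
  have "convex R"
  proof (rule convexI)
    fix p q :: "'a \<times> real" and a b :: real
    assume "p \<in> R" "q \<in> R" and ab: "0 \<le> a" "0 \<le> b" "a + b = 1"
    then obtain s t where st: "s \<ge> 0" "t \<ge> 0" "p = (x + s *\<^sub>R d, f x + s * m)" "q = (x + t *\<^sub>R d, f x + t * m)"
      unfolding R_def by auto
    have b: "b = 1 - a" using ab by simp
    have "a *\<^sub>R p + b *\<^sub>R q = (x + (a * s + b * t) *\<^sub>R d, f x + (a * s + b * t) * m)"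
      unfolding st b by (simp add: algebra_simps)
    then show "a *\<^sub>R p + b *\<^sub>R q \<in> R"
      using st ab unfolding R_def by (intro image_eqI[where x = "a * s + b * t"]) auto
  qed
  moreover have "convex E"
  proof (rule convexI)
    fix p q :: "'a \<times> real" and a b :: real
    assume pq: "p \<in> E" "q \<in> E" and ab: "0 \<le> a" "0 \<le> b" "a + b = 1"
    obtain z s z' s' where e: "p = (z, s)" "q = (z', s')" "f z < s" "f z' < s'"
      using pq unfolding E_def by auto
    have "f (a *\<^sub>R z + b *\<^sub>R z') \<le> a * f z + b * f z'"
      using conv ab unfolding convex_on_def by auto
    also have "\<dots> < a * s + b * s'"
    proof (cases "a = 0")
      case True
      then show ?thesis using ab e by simp
    next
      case False
      then show ?thesis using ab e
        by (intro add_less_le_mono mult_strict_left_mono mult_left_mono) auto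
    qed
    finally show "a *\<^sub>R p + b *\<^sub>R q \<in> E" unfolding E_def e by simp
  qed
  moreover have "R \<noteq> {}" "E \<noteq> {}"
    unfolding R_def E_def by (auto intro: exI[of _ "f x"] gt_ex)
  moreover have "R \<inter> E = {}"
    unfolding R_def E_def using ray by (force simp: not_less)
  ultimately obtain a b where a: "a \<noteq> 0" "\<And>p. p \<in> R \<Longrightarrow> inner a p \<le> b" "\<And>p. p \<in> E \<Longrightarrow> inner a p \<ge> b"
    by (metis separating_hyperplane_sets)
  obtain p q where pq: "a = (p, q)" by (cases a)
  have sep: "p \<bullet> (x + t *\<^sub>R d) + q * (f x + t * m) \<le> p \<bullet> z + q * s" if "t \<ge> 0" "f z < s" for t z s
  proof -
    have "(x + t *\<^sub>R d, f x + t * m) \<in> R" "(z, s) \<in> E"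
      using that unfolding R_def E_def by auto
    from order_trans[OF a(2)[OF this(1)] a(3)[OF this(2)]] show ?thesis
      unfolding pq by (simp add: inner_prod_def)
  qed
  have q0: "q \<ge> 0" using sep[of 0 x "f x + 1"] by (simp add: algebra_simps)
  have "q \<noteq> 0"
  proof
    assume q: "q = 0"
    have "p \<bullet> p \<le> 0" using sep[of 0 "x - p" "f (x - p) + 1"] q by (simp add: inner_diff_right)
    then have "p = 0" by (metis inner_ge_zero inner_eq_zero_iff order_antisym)
    then show False using a(1) pq q by (simp add: zero_prod_def)
  qed
  with q0 have qp: "q > 0" by simp
  have lim: "p \<bullet> (x + t *\<^sub>R d) + q * (f x + t * m) \<le> p \<bullet> z + q * f z" if "t \<ge> 0" for t z
  proof (rule field_le_epsilon)
    fix e :: real assume "e > 0"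
    then show "p \<bullet> (x + t *\<^sub>R d) + q * (f x + t * m) \<le> p \<bullet> z + q * f z + e"
      using sep[OF that, of z "f z + e / q"] qp by (simp add: algebra_simps)
  qed
  show ?thesis
  proof (rule that[of "- p /\<^sub>R q"])
    fix z
    show "f x + (- p /\<^sub>R q) \<bullet> (z - x) \<le> f z"
      using lim[of 0 z] qp by (simp add: field_simps inner_diff_right)
  next
    show "m \<le> (- p /\<^sub>R q) \<bullet> d"
      using lim[of 1 x] qp by (simp add: field_simps inner_add_right)
  qed
qed

text \<open>The generalized derivative is an upper limit over all base points, so it suffices to bound the
  quotients from below along a single path of base points for each direction.\<close>

lemma clarke_subdiff_pathI:
  fixes f :: "'a::real_inner \<Rightarrow> real"
  assumes lim: "\<And>v. (p v \<longlongrightarrow> x) (at_right (0::real))"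
    and quot: "\<And>v t. t > 0 \<Longrightarrow> \<xi> \<bullet> v \<le> (f (p v t + t *\<^sub>R v) - f (p v t)) / t"
  shows "\<xi> \<in> clarke_subdiff f x"
  unfolding clarke_subdiff_def clarke_dir_deriv_def
proof (intro CollectI allI, rule ccontr)
  fix v
  let ?q = "\<lambda>(y, t). ereal ((f (y + t *\<^sub>R v) - f y) / t)"
  assume "\<not> ereal (\<xi> \<bullet> v) \<le> Limsup (nhds x \<times>\<^sub>F at_right 0) ?q"
  then have "\<forall>\<^sub>F p in nhds x \<times>\<^sub>F at_right 0. ?q p < ereal (\<xi> \<bullet> v)"
    by (intro Limsup_lessD) (simp add: not_le)
  moreover have "filterlim (\<lambda>t. (p v t, t)) (nhds x \<times>\<^sub>F at_right 0) (at_right 0)"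
    by (intro filterlim_Pair lim filterlim_ident)
  ultimately have "\<forall>\<^sub>F t in at_right 0. ?q (p v t, t) < ereal (\<xi> \<bullet> v)"
    unfolding filterlim_iff by blast
  moreover have "\<forall>\<^sub>F t::real in at_right 0. t > 0" by (simp add: eventually_at_right_less)
  ultimately have "\<forall>\<^sub>F t::real in at_right 0. False"
  proof eventually_elim
    case (elim t)
    then show ?case using quot[of t v] by auto
  qed
  then show False by simp
qed

lemma subgradient_in_clarke_subdiff:
  fixes f :: "'a::real_inner \<Rightarrow> real"
  assumes "\<And>z. f x + \<xi> \<bullet> (z - x) \<le> f z"
  shows "\<xi> \<in> clarke_subdiff f x"
proof (rule clarke_subdiff_pathI[where p = "\<lambda>v t. x"])
  fix v and t :: real assume "t > 0"
  then show "\<xi> \<bullet> v \<le> (f (x + t *\<^sub>R v) - f x) / t"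
    using assms[of "x + t *\<^sub>R v"] by (simp add: field_simps)
qed simp

text \<open>For a supergradient the forward quotient at \<open>x\<close> is bounded from above only; basing it at
  \<open>x - t *\<^sub>R v\<close> turns it into a backward quotient, for which the bound has the right direction.\<close>

lemma supergradient_in_clarke_subdiff:
  fixes f :: "'a::real_inner \<Rightarrow> real"
  assumes "\<And>z. f z \<le> f x + \<xi> \<bullet> (z - x)"
  shows "\<xi> \<in> clarke_subdiff f x"
proof (rule clarke_subdiff_pathI[where p = "\<lambda>v t. x - t *\<^sub>R v"])
  fix v :: 'a
  have "((\<lambda>t::real. x - t *\<^sub>R v) \<longlongrightarrow> x - 0 *\<^sub>R v) (at_right 0)"
    by (intro tendsto_intros)
  then show "((\<lambda>t::real. x - t *\<^sub>R v) \<longlongrightarrow> x) (at_right 0)" by simp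
next
  fix v and t :: real assume "t > 0"
  then show "\<xi> \<bullet> v \<le> (f (x - t *\<^sub>R v + t *\<^sub>R v) - f (x - t *\<^sub>R v)) / t"
    using assms[of "x - t *\<^sub>R v"] by (simp add: field_simps)
qed

text \<open>The max-norm bound on subgradients is dual to this distance. A coordinate step of length \<open>t\<close> has
  \<open>l1\<close> length exactly \<open>t\<close>, so no dimension-dependent factor enters the threshold for \<open>\<mu>\<close>.\<close>

definition l1_dist :: "real^'d \<Rightarrow> real^'d \<Rightarrow> real" where
  "l1_dist x z = (\<Sum>i\<in>UNIV. \<bar>z $ i - x $ i\<bar>)"

lemma l1_dist_simps [simp]: "l1_dist x x = 0" "l1_dist x z \<ge> 0"
  by (auto simp: l1_dist_def intro: sum_nonneg)

lemma l1_dist_commute: "l1_dist x z = l1_dist z x"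
  by (simp add: l1_dist_def abs_minus_commute)

lemma l1_dist_triangle: "l1_dist x z \<le> l1_dist x y + l1_dist y z"
  unfolding l1_dist_def sum.distrib[symmetric] by (intro sum_mono) auto

lemma dist_le_l1_dist: "dist x z \<le> l1_dist x z"
  using norm_le_l1_cart[of "z - x"] by (simp add: l1_dist_def dist_norm norm_minus_commute)

lemma continuous_on_l1_dist [continuous_intros]: "continuous_on S (l1_dist x)"
  unfolding l1_dist_def[abs_def] by (intro continuous_intros)

lemma l1_lipschitz_imp_continuous_on:
  fixes \<phi> :: "real^'d \<Rightarrow> real"
  assumes "\<And>x z. x \<in> S \<Longrightarrow> z \<in> S \<Longrightarrow> \<phi> z - \<phi> x \<le> L * l1_dist x z"
  shows "continuous_on S \<phi>"
  unfolding continuous_on_def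
proof
  fix x assume x: "x \<in> S"
  have "(l1_dist x \<longlongrightarrow> l1_dist x x) (at x within S)"
    using continuous_on_l1_dist[of S x] x unfolding continuous_on_def by blast
  then have "((\<lambda>z. L * l1_dist x z) \<longlongrightarrow> L * l1_dist x x) (at x within S)"
    by (intro tendsto_intros)
  then have "((\<lambda>z. L * l1_dist x z) \<longlongrightarrow> 0) (at x within S)" by simp
  moreover have "\<forall>\<^sub>F z in at x within S. norm (\<phi> z - \<phi> x) \<le> L * l1_dist x z"
    using assms[OF x] assms[OF _ x]
    by (auto simp: eventually_at_filter abs_le_iff l1_dist_commute[of x] intro!: always_eventually)
  ultimately have "((\<lambda>z. \<phi> z - \<phi> x) \<longlongrightarrow> 0) (at x within S)"
    by (rule Lim_null_comparison[rotated])
  then show "(\<phi> \<longlongrightarrow> \<phi> x) (at x within S)" by (simp add: LIM_zero_iff)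
qed

lemma inner_le_l1_dist:
  fixes \<xi> :: "real^'d"
  assumes "\<xi> \<in> S" "set_infnorm S \<le> ereal L"
  shows "\<xi> \<bullet> (z - x) \<le> L * l1_dist x z"
proof -
  have "ereal (infnorm \<xi>) \<le> ereal L"
    using assms unfolding set_infnorm_def by (meson SUP_le_iff)
  then have "\<bar>\<xi> $ i\<bar> \<le> L" for i
    using component_le_infnorm_cart[of \<xi> i] by simp
  then have "\<bar>\<xi> $ i\<bar> * \<bar>z $ i - x $ i\<bar> \<le> L * \<bar>z $ i - x $ i\<bar>" for i
    by (intro mult_right_mono) auto
  then have "\<xi> $ i * (z $ i - x $ i) \<le> L * \<bar>z $ i - x $ i\<bar>" for i
    unfolding abs_mult[symmetric] by (rule order_trans[OF abs_ge_self])
  then show ?thesis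
    unfolding inner_vec_def l1_dist_def sum_distrib_left by (auto intro!: sum_mono)
qed

text \<open>Only the subdifferential at the end point \<open>z\<close> has to be bounded, since a subgradient at \<open>z\<close> bounds
  the increase from any \<open>x\<close>. This makes the bound uniform, as is needed for value functions.\<close>

lemma convex_l1_lipschitz:
  fixes \<phi> :: "real^'d \<Rightarrow> real"
  assumes "convex_on UNIV \<phi>" "set_infnorm (clarke_subdiff \<phi> z) \<le> ereal L"
  shows "\<phi> z - \<phi> x \<le> L * l1_dist x z"
proof -
  obtain \<xi> where \<xi>: "\<And>y. \<phi> z + \<xi> \<bullet> (y - z) \<le> \<phi> y"
    using convex_subgradient_along_ray[OF assms(1), of z 0 0] by auto
  have "\<xi> \<bullet> (z - x) \<le> L * l1_dist x z"
    using inner_le_l1_dist[OF subgradient_in_clarke_subdiff[of \<phi>, OF \<xi>] assms(2)] .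
  then show ?thesis using \<xi>[of x] by (simp add: inner_diff_right)
qed

lemma concave_l1_lipschitz:
  fixes \<phi> :: "real^'d \<Rightarrow> real"
  assumes "concave_on UNIV \<phi>" "set_infnorm (clarke_subdiff \<phi> z) \<le> ereal L"
  shows "\<phi> x - \<phi> z \<le> L * l1_dist x z"
proof -
  have conv: "convex_on UNIV (\<lambda>y. - \<phi> y)" using assms(1) by (simp add: concave_on_def)
  obtain \<xi> where \<xi>: "\<And>y. - \<phi> z + \<xi> \<bullet> (y - z) \<le> - \<phi> y"
    using convex_subgradient_along_ray[OF conv, of z 0 0] by auto
  have "\<phi> y \<le> \<phi> z + (- \<xi>) \<bullet> (y - z)" for y using \<xi>[of y] by simp
  then have "- \<xi> \<in> clarke_subdiff \<phi> z" by (rule supergradient_in_clarke_subdiff)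
  then have "(- \<xi>) \<bullet> (x - z) \<le> L * l1_dist z x" by (rule inner_le_l1_dist[OF _ assms(2)])
  then show ?thesis
    using \<xi>[of x] by (simp add: l1_dist_commute[of x])
qed

section \<open>The smoothed step\<close>

locale step_density =
  fixes \<rho> :: "real \<Rightarrow> real" and \<alpha> rlo rhi \<mu> :: real
  assumes alpha_pos: "\<alpha> > 0"
    and rho_nonneg: "\<And>s. \<rho> s \<ge> 0"
    and rho_integral: "(\<rho> has_integral 1) UNIV"
    and rho_support: "\<And>s. s \<notin> {0..\<alpha>} \<Longrightarrow> \<rho> s = 0"
    and rlo_pos: "rlo > 0" and rhi_pos: "rhi > 0"
    and rho_bounds: "\<And>s. s \<in> {0<..<\<alpha>} \<Longrightarrow> rlo \<le> \<rho> s \<and> \<rho> s \<le> rhi"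
    and mu_pos: "\<mu> > 0"
begin

abbreviation r :: "real \<Rightarrow> real" where "r t \<equiv> smoothed_step \<rho> t \<mu>"

lemma integrable_halfline: "\<rho> integrable_on {..a}"
proof -
  have "\<rho> absolutely_integrable_on UNIV"
    using rho_integral rho_nonneg by (auto intro!: nonnegative_absolutely_integrable_1)
  then have "set_integrable lebesgue {..a} \<rho>"
    by (rule set_integrable_subset) auto
  then show ?thesis by (rule set_lebesgue_integral_eq_integral)
qed

lemma integrable_interval: "\<rho> integrable_on {a..b}"
  using integrable_on_subinterval[of \<rho> UNIV a b] rho_integral by auto

lemma step_mono: "a \<le> b \<Longrightarrow> r a \<le> r b"
  unfolding smoothed_step_def using mu_pos rho_nonneg
  by (intro integral_subset_le integrable_halfline) (auto simp: divide_right_mono)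

lemma step_nonpos: "t \<le> 0 \<Longrightarrow> r t = 0"
proof -
  assume "t \<le> 0"
  then have t: "t / \<mu> \<le> 0" using mu_pos by (simp add: divide_nonpos_pos)
  have "integral {..t / \<mu>} \<rho> = integral {..t / \<mu>} (\<lambda>_. 0)"
    using t by (intro integral_spike[of "{0}"]) (auto simp: rho_support)
  then show "r t = 0" by (simp add: smoothed_step_def)
qed

lemma step_above: "t \<ge> \<alpha> * \<mu> \<Longrightarrow> r t = 1"
proof -
  assume "t \<ge> \<alpha> * \<mu>"
  then have t: "t / \<mu> \<ge> \<alpha>" using mu_pos by (simp add: pos_le_divide_eq)
  have "(\<lambda>s. if s \<in> {..t / \<mu>} then \<rho> s else 0) = \<rho>"
    using t by (auto simp: fun_eq_iff rho_support)
  then have "(\<rho> has_integral 1) {..t / \<mu>}"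
    using rho_integral has_integral_restrict_UNIV[of "{..t / \<mu>}" \<rho> 1] by simp
  then show "r t = 1" by (simp add: smoothed_step_def integral_unique)
qed

text \<open>Monotonicity and the value 1 beyond \<open>\<alpha> * \<mu>\<close> give the upper bound 1.\<close>

lemma step_le_pos_zero_power: "r t \<le> pos_zero_power t"
  using step_nonpos[of t] step_mono[of t "max t (\<alpha> * \<mu>)"] step_above[of "max t (\<alpha> * \<mu>)"]
  by (auto simp: pos_zero_power_def)

lemma step_eq_pos_zero_power: "t \<notin> {0<..<\<alpha> * \<mu>} \<Longrightarrow> r t = pos_zero_power t"
  using step_nonpos[of t] step_above[of t] by (auto simp: pos_zero_power_def)

lemma step_diff:
  assumes "a \<le> b"
  shows "r b - r a = integral {a / \<mu>..b / \<mu>} \<rho>"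
proof -
  have ab: "a / \<mu> \<le> b / \<mu>" using assms mu_pos by (simp add: divide_right_mono)
  have *: "{..b / \<mu>} = {..a / \<mu>} \<union> {a / \<mu>..b / \<mu>}" using ab by auto
  have "{..a / \<mu>} \<inter> {a / \<mu>..b / \<mu>} = {a / \<mu>}" using ab by auto
  then have "integral {..b / \<mu>} \<rho> = integral {..a / \<mu>} \<rho> + integral {a / \<mu>..b / \<mu>} \<rho>"
    unfolding * by (intro Henstock_Kurzweil_Integration.integral_Un integrable_halfline integrable_interval) auto
  then show ?thesis by (simp add: smoothed_step_def)
qed

text \<open>The bounds on \<open>\<rho>\<close> hold only inside \<open>(0, \<alpha>)\<close>, so the two end points, where the density may
  take any value, are changed on a null set first; likewise for the lower bound below.\<close>

lemma step_diff_le: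
  assumes "a \<le> b"
  shows "r b - r a \<le> rhi / \<mu> * (b - a)"
proof -
  have ab: "a / \<mu> \<le> b / \<mu>" using assms mu_pos by (simp add: divide_right_mono)
  let ?\<rho> = "\<lambda>s. if s \<in> {0, \<alpha>} then 0 else \<rho> s"
  have "integral {a / \<mu>..b / \<mu>} \<rho> = integral {a / \<mu>..b / \<mu>} ?\<rho>"
    by (intro integral_spike[of "{0, \<alpha>}"]) auto
  also have "\<dots> \<le> integral {a / \<mu>..b / \<mu>} (\<lambda>_. rhi)"
  proof (rule integral_le)
    show "?\<rho> integrable_on {a / \<mu>..b / \<mu>}"
      by (rule integrable_spike[OF integrable_interval, of "{0, \<alpha>}"]) auto
    show "?\<rho> s \<le> rhi" for s
      using rho_bounds[of s] rho_support[of s] rhi_pos by (cases "s \<in> {0..\<alpha>}") auto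
  qed auto
  also have "\<dots> = rhi / \<mu> * (b - a)"
    using ab mu_pos by (simp add: field_simps)
  finally show ?thesis using step_diff[OF assms] by simp
qed

lemma step_diff_ge:
  assumes "0 \<le> a" "a \<le> b" "b \<le> \<alpha> * \<mu>"
  shows "rlo / \<mu> * (b - a) \<le> r b - r a"
proof -
  have ab: "a / \<mu> \<le> b / \<mu>" "0 \<le> a / \<mu>" "b / \<mu> \<le> \<alpha>"
    using assms mu_pos by (simp_all add: divide_right_mono pos_divide_le_eq)
  let ?\<rho> = "\<lambda>s. if s \<in> {0, \<alpha>} then rlo else \<rho> s"
  have "rlo / \<mu> * (b - a) = integral {a / \<mu>..b / \<mu>} (\<lambda>_. rlo)"
    using ab mu_pos by (simp add: field_simps)
  also have "\<dots> \<le> integral {a / \<mu>..b / \<mu>} ?\<rho>"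
  proof (rule integral_le)
    show "?\<rho> integrable_on {a / \<mu>..b / \<mu>}"
      by (rule integrable_spike[OF integrable_interval, of "{0, \<alpha>}"]) auto
    show "rlo \<le> ?\<rho> s" if "s \<in> {a / \<mu>..b / \<mu>}" for s
      using rho_bounds[of s] that ab by auto
  qed auto
  also have "\<dots> = integral {a / \<mu>..b / \<mu>} \<rho>"
    by (intro integral_spike[of "{0, \<alpha>}"]) auto
  finally show ?thesis using step_diff[OF assms(2)] by simp
qed

lemma step_lipschitz: "\<bar>r b - r a\<bar> \<le> rhi / \<mu> * \<bar>b - a\<bar>"
  using step_diff_le[of a b] step_diff_le[of b a] step_mono[of a b] step_mono[of b a]
  by (cases "a \<le> b") auto

lemma continuous_on_step: "continuous_on S r"
proof (rule lipschitz_on_continuous_on[of "rhi / \<mu>"], rule lipschitz_onI)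
  show "dist (r a) (r b) \<le> rhi / \<mu> * dist a b" for a b
    using step_lipschitz[of a b] by (simp add: dist_real_def)
  show "0 \<le> rhi / \<mu>" using rhi_pos mu_pos by simp
qed

end

section \<open>Descent inside the smoothing band\<close>

definition step_count :: "('d + 'd \<Rightarrow> real \<Rightarrow> real) \<Rightarrow> real^'d \<Rightarrow> real" where
  "step_count g x = (\<Sum>i\<in>UNIV. pos_zero_power (g (Inl i) (x $ i)) + pos_zero_power (g (Inr i) (x $ i)))"

definition smoothed_count ::
  "(real \<Rightarrow> real) \<Rightarrow> real \<Rightarrow> ('d + 'd \<Rightarrow> real \<Rightarrow> real) \<Rightarrow> real^'d \<Rightarrow> real" where
  "smoothed_count \<rho> \<mu> g x =
     (\<Sum>i\<in>UNIV. smoothed_step \<rho> (g (Inl i) (x $ i)) \<mu> + smoothed_step \<rho> (g (Inr i) (x $ i)) \<mu>)"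

definition off_band :: "real \<Rightarrow> ('d + 'd \<Rightarrow> real \<Rightarrow> real) \<Rightarrow> real^'d \<Rightarrow> bool" where
  "off_band \<nu> g x \<longleftrightarrow> (\<forall>i. g (Inl i) (x $ i) \<notin> {0<..<\<nu>} \<and> g (Inr i) (x $ i) \<notin> {0<..<\<nu>})"

locale relaxed_block = step_density +
  fixes lo hi :: "real^'d" and k :: nat and w :: "nat \<Rightarrow> real^'d \<Rightarrow> real"
    and g :: "'d + 'd \<Rightarrow> real \<Rightarrow> real" and \<tau> \<sigma> :: real
  assumes w_convex: "\<And>t. t \<in> {1..k} \<Longrightarrow> convex_on UNIV (w t)"
    and interior_nonempty: "interior (feasible_set lo hi k w) \<noteq> {}"
    and w_nondegenerate: "\<And>t. t \<in> {1..k} \<Longrightarrow> \<exists>x. w t x < 0"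
    and g_diff: "\<And>p x. g p differentiable at x"
    and cond: "structural_condition lo hi k w g \<tau> \<sigma>"
    and sigma_pos: "\<sigma> > 0"
    and band_less: "\<alpha> * \<mu> < \<tau>"
begin

abbreviation K :: "(real^'d) set" where "K \<equiv> feasible_set lo hi k w"

text \<open>Every interior point will do: if a constraint vanished there, then by convexity it would be
  positive just beyond the interior point on the line from a point where it is negative.\<close>

lemma slater_point: obtains x0 where "x0 \<in> K" "\<And>t. t \<in> {1..k} \<Longrightarrow> w t x0 < 0"
proof -
  obtain x0 where "x0 \<in> interior K" using interior_nonempty by auto
  then obtain e where e: "e > 0" "cball x0 e \<subseteq> K" using mem_interior_cball by blast
  have "w t x0 < 0" if t: "t \<in> {1..k}" for t
  proof (rule ccontr)
    assume not_neg: "\<not> w t x0 < 0"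
    obtain z where z: "w t z < 0" using w_nondegenerate[OF t] by auto
    define s where "s = e / (norm (x0 - z) + e)"
    have s: "0 < s" "s \<le> 1" "s * norm (x0 - z) \<le> e"
      using e(1) by (auto simp: s_def field_simps add_pos_nonneg add_nonneg_pos)
    \<comment> \<open>Passing \<open>x0\<close> on the line from \<open>z\<close> by a step short enough to stay in the ball.\<close>
    define y where "y = x0 + s *\<^sub>R (x0 - z)"
    have "y \<in> cball x0 e" using s by (simp add: y_def dist_norm)
    then have y: "w t y \<le> 0" using e(2) t unfolding feasible_set_def by auto
    define a where "a = s / (1 + s)"
    have a: "0 < a" "a < 1" "a * (1 + s) = s" using s by (auto simp: a_def)
    have as: "(1 - a) * s = a" using a by (simp add: algebra_simps)
    have "(1 - a) *\<^sub>R y + a *\<^sub>R z = (1 - a) *\<^sub>R x0 + ((1 - a) * s) *\<^sub>R (x0 - z) + a *\<^sub>R z"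
      unfolding y_def scaleR_add_right scaleR_scaleR ..
    also have "\<dots> = x0" unfolding as by (simp add: algebra_simps)
    finally have "w t x0 \<le> (1 - a) * w t y + a * w t z"
      using convex_onD[OF w_convex[OF t], of a y z] a by simp
    also have "\<dots> < 0"
      using a y z by (intro add_nonpos_neg mult_nonneg_nonpos mult_pos_neg) auto
    finally show False using not_neg by simp
  qed
  moreover have "x0 \<in> K" using e by (meson centre_in_cball less_imp_le subsetD)
  ultimately show ?thesis using that by blast
qed

lemma continuous_on_w: "t \<in> {1..k} \<Longrightarrow> continuous_on S (w t)"
  by (metis w_convex convex_on_continuous continuous_on_subset open_UNIV subset_UNIV)

lemma compact_K: "compact K"
proof -
  have "{x. \<forall>t\<in>{1..k}. w t x \<le> 0} = (\<Inter>t\<in>{1..k}. {x. w t x \<le> 0})" by auto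
  moreover have "closed {x. w t x \<le> 0}" if "t \<in> {1..k}" for t
    by (intro closed_Collect_le continuous_on_w that continuous_on_const)
  ultimately have "closed {x. \<forall>t\<in>{1..k}. w t x \<le> 0}"
    using closed_INT[of "{1..k}" "\<lambda>t. {x. w t x \<le> 0}"] by simp
  then show ?thesis unfolding feasible_set_def by (simp add: compact_Int_closed)
qed

text \<open>A direction that pairs nonpositively with all active subgradients is only tangent to the feasible
  set; an arbitrarily small tilt \<open>e\<close> towards a Slater point makes it feasible.\<close>

lemma eventually_feasible:
  assumes x: "x \<in> K" and xi: "x $ i \<in> interior {lo $ i..hi $ i}"
    and dir: "\<And>t \<xi>. t \<in> active_set k w x \<Longrightarrow> \<xi> \<in> clarke_subdiff (w t) x \<Longrightarrow> \<xi> $ i * a \<le> 0"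
    and x0: "x0 \<in> K" "\<And>t. t \<in> {1..k} \<Longrightarrow> w t x0 < 0"
    and e: "0 < e" "e \<le> 1"
  shows "\<forall>\<^sub>F t in at_right 0. x + t *\<^sub>R (axis i a + e *\<^sub>R (x0 - x)) \<in> K"
proof -
  define d where "d = axis i a + e *\<^sub>R (x0 - x)"
  have lim: "((\<lambda>t. x + t *\<^sub>R d) \<longlongrightarrow> x) (at_right (0::real))"
    by (rule tendsto_eq_intros refl | simp)+
  have box: "\<forall>j. lo $ j \<le> x $ j \<and> x $ j \<le> hi $ j" "\<forall>j. lo $ j \<le> x0 $ j \<and> x0 $ j \<le> hi $ j"
    using x x0(1) unfolding feasible_set_def by (auto simp: mem_box_cart)
  have "\<forall>\<^sub>F t in at_right 0. (x + t *\<^sub>R d) $ i \<in> interior {lo $ i..hi $ i}"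
    by (rule topological_tendstoD[OF tendsto_vec_nth[OF lim]]) (use xi in auto)
  moreover have "\<forall>\<^sub>F t::real in at_right 0. 0 < t \<and> t < 1"
    using eventually_at_right_real[of 0 1] by simp
  ultimately have "\<forall>\<^sub>F t in at_right 0. x + t *\<^sub>R d \<in> cbox lo hi"
  proof eventually_elim
    case (elim t)
    have "lo $ j \<le> (x + t *\<^sub>R d) $ j \<and> (x + t *\<^sub>R d) $ j \<le> hi $ j" for j
    proof (cases "j = i")
      case True
      then show ?thesis using elim(1) interior_subset by fastforce
    next
      case False
      have te: "0 \<le> t * e" "t * e \<le> 1" using elim e by (auto intro: mult_le_one)
      have "(x + t *\<^sub>R d) $ j = (1 - t * e) * x $ j + t * e * x0 $ j"
        using False by (simp add: d_def axis_def algebra_simps)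
      moreover have "(1 - t * e) * x $ j + t * e * x0 $ j \<in> {lo $ j..hi $ j}"
        using convexD_alt[of "{lo $ j..hi $ j}" "x $ j" "x0 $ j" "t * e"] box te by simp
      ultimately show ?thesis by simp
    qed
    then show ?case by (simp add: mem_box_cart)
  qed
  moreover have "\<forall>\<^sub>F s in at_right 0. \<forall>t\<in>{1..k}. w t (x + s *\<^sub>R d) \<le> 0"
  proof (intro eventually_ball_finite ballI)
    fix t assume t: "t \<in> {1..k}"
    show "\<forall>\<^sub>F s in at_right 0. w t (x + s *\<^sub>R d) \<le> 0"
    proof (cases "w t x = 0")
      case False
      then have "w t x < 0" using x t unfolding feasible_set_def by force
      moreover have "isCont (w t) x"
        using continuous_on_w[OF t, of UNIV] by (simp add: continuous_on_eq_continuous_at)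
      then have "((\<lambda>s. w t (x + s *\<^sub>R d)) \<longlongrightarrow> w t x) (at_right 0)"
        by (rule isCont_tendsto_compose[OF _ lim])
      ultimately have "\<forall>\<^sub>F s in at_right 0. w t (x + s *\<^sub>R d) < 0"
        by (simp add: order_tendstoD)
      then show ?thesis by eventually_elim simp
    next
      case True
      \<comment> \<open>Otherwise \<open>w t\<close> would have a subgradient pairing nonnegatively with \<open>d\<close>. But every subgradient
        pairs nonpositively with the coordinate part, by assumption, and negatively with the part that
        points at the Slater point.\<close>
      have "\<exists>s\<ge>0. w t (x + s *\<^sub>R d) < 0"
      proof (rule ccontr)
        assume "\<not> ?thesis"
        then have "\<And>s. s \<ge> 0 \<Longrightarrow> w t x + s * 0 \<le> w t (x + s *\<^sub>R d)" using True by force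
        then obtain \<xi> where \<xi>: "\<And>z. w t x + \<xi> \<bullet> (z - x) \<le> w t z" "0 \<le> \<xi> \<bullet> d"
          using convex_subgradient_along_ray[OF w_convex[OF t]] by metis
        have "\<xi> $ i * a \<le> 0"
          using dir[of t \<xi>] subgradient_in_clarke_subdiff[of "w t" x \<xi>, OF \<xi>(1)] t True
          by (simp add: active_set_def)
        moreover have "\<xi> \<bullet> (x0 - x) < 0" using \<xi>(1)[of x0] x0(2)[OF t] True by simp
        then have "e * (\<xi> \<bullet> (x0 - x)) < 0" using e by (simp add: mult_pos_neg)
        ultimately show False
          using \<xi>(2) by (simp add: d_def inner_add_right inner_axis)
      qed
      then obtain s0 where s0: "s0 \<ge> 0" "w t (x + s0 *\<^sub>R d) < 0" by blast
      then have s0_pos: "s0 > 0" using True by (cases "s0 = 0") auto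
      then have "\<forall>\<^sub>F s in at_right 0. 0 < s \<and> s < s0"
        using eventually_at_right_real[OF s0_pos] by (simp add: eventually_conj)
      then show ?thesis
      proof eventually_elim
        case (elim s)
        define b where "b = s / s0"
        have b: "0 \<le> b" "b \<le> 1" "b * s0 = s" using elim s0_pos by (auto simp: b_def)
        have "(1 - b) *\<^sub>R x + b *\<^sub>R (x + s0 *\<^sub>R d) = x + s *\<^sub>R d"
          unfolding b(3)[symmetric] by (simp add: algebra_simps)
        then have "w t (x + s *\<^sub>R d) \<le> (1 - b) * w t x + b * w t (x + s0 *\<^sub>R d)"
          using convex_onD[OF w_convex[OF t], of b x "x + s0 *\<^sub>R d"] b by simp
        also have "\<dots> \<le> 0" using True b s0 by (simp add: mult_nonneg_nonpos)
        finally show ?case .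
      qed
    qed
  qed simp
  ultimately show ?thesis
    unfolding d_def[symmetric] feasible_set_def by eventually_elim auto
qed

lemma g_quotient_tendsto:
  "((\<lambda>t. (g p (\<xi> + t * e) - g p \<xi>) / t) \<longlongrightarrow> deriv (g p) \<xi> * e) (at_right 0)"
proof -
  have "(g p has_real_derivative deriv (g p) \<xi>) (at (\<xi> + 0 * e))"
    using g_diff[of p \<xi>] by (simp add: DERIV_deriv_iff_real_differentiable)
  then have "((\<lambda>t. g p (\<xi> + t * e)) has_real_derivative deriv (g p) \<xi> * e) (at 0)"
    by (rule DERIV_chain2) (auto intro!: derivative_eq_intros)
  then have "((\<lambda>t. (g p (\<xi> + t * e) - g p \<xi>) / t) \<longlongrightarrow> deriv (g p) \<xi> * e) (at 0)"
    by (simp add: DERIV_def)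
  then show ?thesis by (rule tendsto_within_subset) simp
qed

lemma continuous_g: "isCont (g p) \<xi>"
  using g_diff differentiable_imp_continuous_within by blast

lemma g_line_tendsto: "((\<lambda>t. g p (\<xi> + t * e)) \<longlongrightarrow> g p \<xi>) (at_right 0)"
  by (rule isCont_tendsto_compose[OF continuous_g]) (rule tendsto_eq_intros refl | simp)+

lemma eventually_step_increase_le:
  "\<forall>\<^sub>F t in at_right 0. r (g p (\<xi> + t * e)) - r (g p \<xi>)
     \<le> t * (rhi / \<mu> * (\<bar>deriv (g p) \<xi>\<bar> + 1) * \<bar>e\<bar>)"
proof (cases "e = 0")
  case False
  then have "\<bar>deriv (g p) \<xi> * e\<bar> < (\<bar>deriv (g p) \<xi>\<bar> + 1) * \<bar>e\<bar>" by (simp add: abs_mult)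
  then have "\<forall>\<^sub>F t in at_right 0. \<bar>(g p (\<xi> + t * e) - g p \<xi>) / t\<bar> < (\<bar>deriv (g p) \<xi>\<bar> + 1) * \<bar>e\<bar>"
    using order_tendstoD(2)[OF tendsto_rabs[OF g_quotient_tendsto]] by blast
  moreover have "\<forall>\<^sub>F t::real in at_right 0. t > 0" by (simp add: eventually_at_right_less)
  ultimately show ?thesis
  proof eventually_elim
    case (elim t)
    then have le: "\<bar>g p (\<xi> + t * e) - g p \<xi>\<bar> \<le> t * ((\<bar>deriv (g p) \<xi>\<bar> + 1) * \<bar>e\<bar>)"
      by (simp add: abs_divide pos_divide_less_eq mult.commute)
    have "r (g p (\<xi> + t * e)) - r (g p \<xi>) \<le> rhi / \<mu> * \<bar>g p (\<xi> + t * e) - g p \<xi>\<bar>"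
      using step_lipschitz[of "g p (\<xi> + t * e)" "g p \<xi>"] by (simp add: abs_le_iff)
    also have "\<dots> \<le> rhi / \<mu> * (t * ((\<bar>deriv (g p) \<xi>\<bar> + 1) * \<bar>e\<bar>))"
      using le rhi_pos mu_pos by (intro mult_left_mono) auto
    finally show ?case by (simp add: mult_ac)
  qed
qed simp

lemma eventually_step_decrease:
  assumes band: "g p \<xi> \<in> {0<..<\<alpha> * \<mu>}" and rate: "deriv (g p) \<xi> * e < - \<beta>" and \<beta>: "\<beta> \<ge> 0"
  shows "\<forall>\<^sub>F t in at_right 0. r (g p (\<xi> + t * e)) - r (g p \<xi>) \<le> - t * (rlo / \<mu> * \<beta>)"
proof -
  have "\<forall>\<^sub>F t in at_right 0. (g p (\<xi> + t * e) - g p \<xi>) / t < - \<beta>"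
    by (rule order_tendstoD(2)[OF g_quotient_tendsto rate])
  moreover have "\<forall>\<^sub>F t in at_right 0. g p (\<xi> + t * e) > 0"
    by (rule order_tendstoD(1)[OF g_line_tendsto]) (use band in simp)
  moreover have "\<forall>\<^sub>F t::real in at_right 0. t > 0" by (simp add: eventually_at_right_less)
  ultimately show ?thesis
  proof eventually_elim
    case (elim t)
    then have le: "t * \<beta> \<le> g p \<xi> - g p (\<xi> + t * e)"
      by (simp add: pos_divide_less_eq mult.commute)
    moreover have "0 \<le> t * \<beta>" using elim \<beta> by simp
    ultimately have "rlo / \<mu> * (g p \<xi> - g p (\<xi> + t * e)) \<le> r (g p \<xi>) - r (g p (\<xi> + t * e))"
      using elim band by (intro step_diff_ge) auto
    moreover have "rlo / \<mu> * (t * \<beta>) \<le> rlo / \<mu> * (g p \<xi> - g p (\<xi> + t * e))"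
      using le rlo_pos mu_pos by (intro mult_left_mono) auto
    ultimately show ?case by (simp add: algebra_simps)
  qed
qed

lemma eventually_step_constant:
  assumes "g p \<xi> \<notin> {0..\<tau>}"
  shows "\<forall>\<^sub>F t in at_right 0. r (g p (\<xi> + t * e)) = r (g p \<xi>)"
proof (cases "g p \<xi> < 0")
  case True
  have "\<forall>\<^sub>F t in at_right 0. g p (\<xi> + t * e) < 0"
    by (rule order_tendstoD(2)[OF g_line_tendsto True])
  then show ?thesis by eventually_elim (use True in \<open>simp add: step_nonpos\<close>)
next
  case False
  then have gt: "g p \<xi> > \<alpha> * \<mu>" using assms band_less by auto
  have "\<forall>\<^sub>F t in at_right 0. g p (\<xi> + t * e) > \<alpha> * \<mu>"
    by (rule order_tendstoD(1)[OF g_line_tendsto gt])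
  then show ?thesis by eventually_elim (use gt in \<open>simp add: step_above\<close>)
qed

text \<open>The descent argument. The function \<open>\<phi>\<close> will be \<open>c\<close> or \<open>- c\<close> in one variable, a value function, or a
  penalized version. Along \<open>axis i a + e *\<^sub>R v\<close>, with \<open>v\<close> pointing at a Slater point, the smoothed step
  of \<open>g p\<close> falls at rate about \<open>\<sigma> * rlo / \<mu>\<close>, its partner \<open>g q\<close> stays outside
  the band with unchanged smoothed step, and all other coordinates contribute \<open>O(e)\<close>.\<close>

lemma local_min_off_band:
  assumes x: "x \<in> K" and \<delta>: "\<delta> > 0"
    and min: "\<And>z. z \<in> K \<inter> cball x \<delta> \<Longrightarrow> \<phi> x + lam * smoothed_count \<rho> \<mu> g x \<le> \<phi> z + lam * smoothed_count \<rho> \<mu> g z"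
    and lip: "\<And>z. z \<in> K \<Longrightarrow> \<phi> z - \<phi> x \<le> L * l1_dist x z"
    and lam: "lam > 0" and L0: "L \<ge> 0" and L: "L < lam * \<sigma> * rlo / \<mu>"
  shows "off_band (\<alpha> * \<mu>) g x"
proof (rule ccontr)
  assume "\<not> off_band (\<alpha> * \<mu>) g x"
  then obtain i p q where pq: "(p, q) \<in> {(Inl i, Inr i), (Inr i, Inl i)}"
    and band: "g p (x $ i) \<in> {0<..<\<alpha> * \<mu>}"
    unfolding off_band_def by blast
  define D where "D = deriv (g p) (x $ i)"
  have "g p (x $ i) \<in> {0<..<\<tau>}" using band band_less by auto
  then have A: "x $ i \<in> interior {lo $ i..hi $ i}" "g q (x $ i) \<notin> {0..\<tau>}" "\<bar>D\<bar> \<ge> \<sigma>"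
    "\<And>t \<xi>. t \<in> active_set k w x \<Longrightarrow> \<xi> \<in> clarke_subdiff (w t) x \<Longrightarrow> \<xi> $ i * D \<ge> 0"
    using cond x pq unfolding structural_condition_def D_def by blast+
  have D0: "D \<noteq> 0" using A(3) sigma_pos by auto
  define a where "a = - sgn D"
  have a: "\<bar>a\<bar> = 1" "D * a = - \<bar>D\<bar>" using D0 by (auto simp: a_def sgn_real_def)
  have dir: "\<xi> $ i * a \<le> 0" if "t \<in> active_set k w x" "\<xi> \<in> clarke_subdiff (w t) x" for t \<xi>
    using A(4)[OF that] D0 by (auto simp: a_def sgn_real_def zero_le_mult_iff)
  obtain x0 where x0: "x0 \<in> K" "\<And>t. t \<in> {1..k} \<Longrightarrow> w t x0 < 0" using slater_point by blast
  define v where "v = x0 - x"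
  define W where "W = l1_dist x x0"
  define C where "C = (\<Sum>j\<in>UNIV. (rhi / \<mu> * (\<bar>deriv (g (Inl j)) (x $ j)\<bar> + 1) +
                            rhi / \<mu> * (\<bar>deriv (g (Inr j)) (x $ j)\<bar> + 1)) * \<bar>v $ j\<bar>)"
  have W0: "W \<ge> 0" by (simp add: W_def)
  have vW: "\<bar>v $ i\<bar> \<le> W"
    unfolding v_def W_def l1_dist_def
    using member_le_sum[of i UNIV "\<lambda>j. \<bar>x0 $ j - x $ j\<bar>"] by simp
  \<comment> \<open>The rate of change of the objective along \<open>axis i a + e v\<close> is at most this function of \<open>e\<close>,
    which is negative at \<open>e = 0\<close>.\<close>
  define R where "R = (\<lambda>e. L * (1 + e * W) + lam * (e * C) - lam * (rlo / \<mu> * (\<sigma> * (1 - e * (W + 1)))))"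
  have lim: "(R \<longlongrightarrow> L * (1 + 0 * W) + lam * (0 * C) - lam * (rlo / \<mu> * (\<sigma> * (1 - 0 * (W + 1))))) (at_right 0)"
    unfolding R_def by (intro tendsto_intros)
  have R0: "L * (1 + 0 * W) + lam * (0 * C) - lam * (rlo / \<mu> * (\<sigma> * (1 - 0 * (W + 1)))) < 0"
    using L by (simp add: field_simps)
  have "\<forall>\<^sub>F e in at_right 0. R e < 0" by (rule order_tendstoD(2)[OF lim R0])
  moreover have "\<forall>\<^sub>F e in at_right 0. 0 < e \<and> e < 1 / (W + 1)"
    using eventually_at_right_real[of 0 "1 / (W + 1)"] W0 by (simp add: eventually_conj)
  ultimately have "\<forall>\<^sub>F e in at_right 0. R e < 0 \<and> 0 < e \<and> e < 1 / (W + 1)"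
    by eventually_elim simp
  then obtain e where e: "R e < 0" "0 < e" "e < 1 / (W + 1)"
    using eventually_happens'[OF trivial_limit_at_right_real] by blast
  have e1: "e * (W + 1) < 1" using e W0 by (simp add: field_simps)
  have "e * 1 \<le> e * (W + 1)" using e W0 by (intro mult_left_mono) auto
  with e1 have e_le: "e \<le> 1" by simp
  define d where "d = axis i a + e *\<^sub>R v"
  define \<beta> where "\<beta> = \<sigma> * (1 - e * (W + 1))"
  have \<beta>0: "\<beta> \<ge> 0" using sigma_pos e1 by (simp add: \<beta>_def)
  have d_i: "d $ i = a + e * v $ i" and d_j: "\<And>j. j \<noteq> i \<Longrightarrow> d $ j = e * v $ j"
    by (simp_all add: d_def axis_def)
  have rate: "D * d $ i < - \<beta>"
  proof -
    have "D * (e * v $ i) \<le> \<bar>D\<bar> * (e * \<bar>v $ i\<bar>)"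
      by (rule order_trans[OF abs_ge_self]) (use e in \<open>simp add: abs_mult\<close>)
    also have "\<dots> \<le> \<bar>D\<bar> * (e * W)" using vW e by (intro mult_left_mono) auto
    finally have "D * d $ i \<le> - \<bar>D\<bar> * (1 - e * W)"
      using a(2) by (simp add: d_i algebra_simps)
    also have "\<dots> \<le> - \<sigma> * (1 - e * W)"
      using A(3) e1 e(2) by (intro mult_right_mono) (auto simp: algebra_simps)
    also have "\<dots> < - \<beta>" using sigma_pos e(2) by (simp add: \<beta>_def algebra_simps)
    finally show ?thesis .
  qed
  let ?z = "\<lambda>t. x + t *\<^sub>R d"
  have z_comp: "?z t $ j = x $ j + t * d $ j" for t j by simp
  have "((\<lambda>t. ?z t) \<longlongrightarrow> x) (at_right (0::real))"
    by (rule tendsto_eq_intros refl | simp)+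
  then have ev1: "\<forall>\<^sub>F t in at_right 0. dist (?z t) x < \<delta>" by (rule tendstoD[OF _ \<delta>])
  have ev2: "\<forall>\<^sub>F t in at_right 0. ?z t \<in> K"
    unfolding d_def v_def
    by (rule eventually_feasible[OF x A(1) dir x0 e(2) e_le])
  have ev3: "\<forall>\<^sub>F t in at_right 0.
      (r (g (Inl i) (?z t $ i)) + r (g (Inr i) (?z t $ i))) - (r (g (Inl i) (x $ i)) + r (g (Inr i) (x $ i)))
        \<le> - t * (rlo / \<mu> * \<beta>)"
  proof -
    have dec: "\<forall>\<^sub>F t in at_right 0. r (g p (x $ i + t * d $ i)) - r (g p (x $ i)) \<le> - t * (rlo / \<mu> * \<beta>)"
      by (rule eventually_step_decrease[OF band rate[unfolded D_def] \<beta>0])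
    have con: "\<forall>\<^sub>F t in at_right 0. r (g q (x $ i + t * d $ i)) = r (g q (x $ i))"
      by (rule eventually_step_constant[OF A(2)])
    from dec con show ?thesis
    proof eventually_elim
      case (elim t)
      then show ?case using pq unfolding z_comp by auto
    qed
  qed
  have ev4: "\<forall>\<^sub>F t in at_right 0. \<forall>j\<in>UNIV - {i}.
      (r (g (Inl j) (?z t $ j)) + r (g (Inr j) (?z t $ j))) - (r (g (Inl j) (x $ j)) + r (g (Inr j) (x $ j)))
        \<le> t * (e * ((rhi / \<mu> * (\<bar>deriv (g (Inl j)) (x $ j)\<bar> + 1) +
                 rhi / \<mu> * (\<bar>deriv (g (Inr j)) (x $ j)\<bar> + 1)) * \<bar>v $ j\<bar>))"
  proof (intro eventually_ball_finite ballI)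
    fix j assume j: "j \<in> UNIV - {i}"
    have abs_d: "\<bar>d $ j\<bar> = e * \<bar>v $ j\<bar>" using d_j[of j] j e by (simp add: abs_mult)
    show "\<forall>\<^sub>F t in at_right 0.
      (r (g (Inl j) (?z t $ j)) + r (g (Inr j) (?z t $ j))) - (r (g (Inl j) (x $ j)) + r (g (Inr j) (x $ j)))
        \<le> t * (e * ((rhi / \<mu> * (\<bar>deriv (g (Inl j)) (x $ j)\<bar> + 1) +
                 rhi / \<mu> * (\<bar>deriv (g (Inr j)) (x $ j)\<bar> + 1)) * \<bar>v $ j\<bar>))"
      using eventually_step_increase_le[of "Inl j" "x $ j" "d $ j"]
        eventually_step_increase_le[of "Inr j" "x $ j" "d $ j"]
    proof eventually_elim
      case (elim t)
      have "t * (e * ((A + B) * V)) = t * (A * (e * V)) + t * (B * (e * V))" for A B V :: real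
        by (simp add: algebra_simps)
      then show ?case using elim unfolding z_comp abs_d by simp
    qed
  qed simp
  have "\<forall>\<^sub>F t::real in at_right 0. t > 0" by (simp add: eventually_at_right_less)
  with ev1 ev2 ev3 ev4 have "\<forall>\<^sub>F t::real in at_right 0. False"
  proof eventually_elim
    case (elim t)
    let ?S = "\<lambda>y j. r (g (Inl j) (y $ j)) + r (g (Inr j) (y $ j))"
    let ?C = "\<lambda>j. (rhi / \<mu> * (\<bar>deriv (g (Inl j)) (x $ j)\<bar> + 1) +
                 rhi / \<mu> * (\<bar>deriv (g (Inr j)) (x $ j)\<bar> + 1)) * \<bar>v $ j\<bar>"
    have "smoothed_count \<rho> \<mu> g (?z t) - smoothed_count \<rho> \<mu> g x = (\<Sum>j\<in>UNIV. ?S (?z t) j - ?S x j)"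
      by (simp add: smoothed_count_def sum_subtractf)
    also have "\<dots> = (?S (?z t) i - ?S x i) + (\<Sum>j\<in>UNIV - {i}. ?S (?z t) j - ?S x j)"
      by (rule sum.remove) auto
    also have "\<dots> \<le> - t * (rlo / \<mu> * \<beta>) + (\<Sum>j\<in>UNIV - {i}. t * (e * ?C j))"
      by (intro add_mono elim(3) sum_mono) (use elim(4) in blast)
    also have "(\<Sum>j\<in>UNIV - {i}. t * (e * ?C j)) \<le> (\<Sum>j\<in>UNIV. t * (e * ?C j))"
      using elim(5) e rhi_pos mu_pos by (intro sum_mono2) auto
    also have "(\<Sum>j\<in>UNIV. t * (e * ?C j)) = t * (e * C)"
      unfolding C_def by (simp add: sum_distrib_left)
    finally have count: "smoothed_count \<rho> \<mu> g (?z t) - smoothed_count \<rho> \<mu> g x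
        \<le> t * (e * C - rlo / \<mu> * \<beta>)"
      by (simp add: algebra_simps)
    have "\<bar>?z t $ j - x $ j\<bar> \<le> t * ((if j = i then 1 else 0) + e * \<bar>x0 $ j - x $ j\<bar>)" for j
    proof -
      have "\<bar>d $ j\<bar> \<le> (if j = i then 1 else 0) + e * \<bar>x0 $ j - x $ j\<bar>"
        using a(1) e(2) d_i d_j[of j] abs_triangle_ineq[of a "e * v $ i"]
        by (auto simp: v_def abs_mult)
      then show ?thesis using elim(5) by (simp add: abs_mult)
    qed
    then have "l1_dist x (?z t) \<le> (\<Sum>j\<in>UNIV. t * ((if j = i then 1 else 0) + e * \<bar>x0 $ j - x $ j\<bar>))"
      unfolding l1_dist_def by (rule sum_mono)
    also have "\<dots> = t * (1 + e * W)"
      by (simp add: W_def l1_dist_def sum.distrib sum_distrib_left[symmetric])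
    finally have dist: "l1_dist x (?z t) \<le> t * (1 + e * W)" .
    have "\<phi> (?z t) - \<phi> x \<le> L * l1_dist x (?z t)" by (rule lip[OF elim(2)])
    also have "\<dots> \<le> L * (t * (1 + e * W))" by (rule mult_left_mono[OF dist L0])
    finally have "\<phi> (?z t) - \<phi> x + lam * (smoothed_count \<rho> \<mu> g (?z t) - smoothed_count \<rho> \<mu> g x)
        \<le> L * (t * (1 + e * W)) + lam * (t * (e * C - rlo / \<mu> * \<beta>))"
      using mult_left_mono[OF count, of lam] lam by linarith
    also have "\<dots> = t * R e" unfolding R_def \<beta>_def by (simp add: algebra_simps)
    also have "\<dots> < 0" using elim(5) e(1) by (rule mult_pos_neg)
    finally show False using min[of "?z t"] elim(1,2) by (simp add: dist_commute algebra_simps)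
  qed
  then show False by simp
qed

end

section \<open>Exact relaxations of one variable\<close>

text \<open>If no maximum were attained, the relatively open sets on which \<open>F\<close> is less than one of its values
  would cover \<open>S\<close>; the largest of the values belonging to a finite subcover would be less than another.\<close>

lemma usc_attains_max:
  fixes F :: "'a::topological_space \<Rightarrow> real"
  assumes S: "compact S" "S \<noteq> {}"
    and usc: "\<And>y s. y \<in> S \<Longrightarrow> F y < s \<Longrightarrow> \<forall>\<^sub>F z in at y within S. F z < s"
  shows "\<exists>M. is_maximum F S M"
proof (rule ccontr)
  assume no_max: "\<not> ?thesis"
  have ex: "\<exists>z\<in>S. F y < F z" if "y \<in> S" for y
    using no_max that unfolding is_maximum_def by (meson imageI not_le)
  have "\<exists>U z. open U \<and> y \<in> U \<and> z \<in> S \<and> (\<forall>x\<in>U \<inter> S. F x < F z)" if y: "y \<in> S" for y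
  proof -
    obtain z where z: "z \<in> S" "F y < F z" using ex[OF y] by blast
    obtain U where U: "open U" "y \<in> U" "\<forall>x\<in>U. x \<noteq> y \<longrightarrow> x \<in> S \<longrightarrow> F x < F z"
      using usc[OF y z(2)] unfolding eventually_at_topological by blast
    then have "\<forall>x\<in>U \<inter> S. F x < F z" using z(2) by auto
    then show ?thesis using U z(1) by metis
  qed
  then obtain U Z where U: "\<And>y. y \<in> S \<Longrightarrow> open (U y)" "\<And>y. y \<in> S \<Longrightarrow> y \<in> U y"
    and Z: "\<And>y. y \<in> S \<Longrightarrow> Z y \<in> S" "\<And>y x. y \<in> S \<Longrightarrow> x \<in> U y \<inter> S \<Longrightarrow> F x < F (Z y)"
    by metis
  have cover: "S \<subseteq> (\<Union>y\<in>S. U y)" using U(2) by auto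
  obtain T where T: "T \<subseteq> S" "finite T" "S \<subseteq> (\<Union>y\<in>T. U y)"
    by (rule compactE_image[OF S(1) _ cover]) (rule U(1))
  have fin: "finite ((F \<circ> Z) ` T)" "(F \<circ> Z) ` T \<noteq> {}" using T S(2) by auto
  obtain y where y: "y \<in> T" "F (Z y) = Max ((F \<circ> Z) ` T)" using Max_in[OF fin] by auto
  have Zy: "Z y \<in> S" using Z(1) y(1) T(1) by auto
  then obtain y' where y': "y' \<in> T" "Z y \<in> U y'" using T(3) by auto
  have "F (Z y) < F (Z y')" using Z(2)[of y' "Z y"] y' Zy T(1) by auto
  moreover have "F (Z y') \<le> F (Z y)" unfolding y(2) using fin y'(1) by (intro Max_ge) auto
  ultimately show False by simp
qed

lemma modulus_at_point:
  fixes \<psi> :: "'a::metric_space \<Rightarrow> real"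
  assumes S: "compact S" and cont: "continuous_on S \<psi>" and a: "a \<in> S" "\<psi> a = 0"
    and nonneg: "\<And>x. x \<in> S \<Longrightarrow> \<psi> x \<ge> 0"
  obtains \<omega> :: "real \<Rightarrow> real" where "\<And>\<delta>. \<delta> \<ge> 0 \<Longrightarrow> \<omega> \<delta> \<ge> 0" "(\<omega> \<longlongrightarrow> 0) (at_right 0)"
    "\<And>\<delta> x. x \<in> S \<inter> cball a \<delta> \<Longrightarrow> \<psi> x \<le> \<omega> \<delta>"
proof -
  define \<omega> where "\<omega> \<delta> = (SUP x\<in>S \<inter> cball a \<delta>. \<psi> x)" for \<delta>
  have "bdd_above (\<psi> ` S)"
    using compact_continuous_image[OF cont S] by (simp add: compact_imp_bounded bounded_imp_bdd_above)
  then have bdd: "bdd_above (\<psi> ` (S \<inter> cball a \<delta>))" for \<delta>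
    by (rule bdd_above_mono) auto
  have upper: "\<psi> x \<le> \<omega> \<delta>" if "x \<in> S \<inter> cball a \<delta>" for x \<delta>
    unfolding \<omega>_def by (rule cSUP_upper[OF that bdd])
  have pos: "\<omega> \<delta> \<ge> 0" if "\<delta> \<ge> 0" for \<delta> using upper[of a \<delta>] a that by simp
  have lim: "(\<omega> \<longlongrightarrow> 0) (at_right 0)"
  proof (rule tendstoI)
    fix e :: real assume e: "e > 0"
    obtain d where d: "d > 0" "\<And>x. x \<in> S \<Longrightarrow> dist x a < d \<Longrightarrow> dist (\<psi> x) (\<psi> a) < e / 2"
      using cont a(1) e unfolding continuous_on_iff by (metis half_gt_zero)
    show "\<forall>\<^sub>F \<delta> in at_right 0. dist (\<omega> \<delta>) 0 < e"
      using eventually_at_right_real[OF d(1)]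
    proof eventually_elim
      case (elim \<delta>)
      have "\<omega> \<delta> \<le> e / 2"
        unfolding \<omega>_def
      proof (rule cSUP_least)
        show "S \<inter> cball a \<delta> \<noteq> {}" using a elim by auto
        show "\<psi> x \<le> e / 2" if "x \<in> S \<inter> cball a \<delta>" for x
          using d(2)[of x] that elim a(2) by (auto simp: dist_commute dist_real_def)
      qed
      then show ?case using pos[of \<delta>] elim e by simp
    qed
  qed
  show ?thesis by (rule that[OF pos lim upper])
qed

text \<open>What the minimax arguments need to know about one variable: \<open>AR\<close> is a continuous minorant of the
  lower semicontinuous \<open>A\<close>, exact at \<open>good\<close> points, and \<open>Lcrit\<close> is a Lipschitz threshold below which every local
  minimizer of a perturbed relaxation is good.\<close>

locale exact_relaxation =
  fixes S :: "(real^'d) set" and A AR :: "real^'d \<Rightarrow> real" and good :: "real^'d \<Rightarrow> bool" and Lcrit :: real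
  assumes compact_S: "compact S"
    and continuous_AR: "continuous_on T AR"
    and A_lsc: "\<forall>\<^sub>F z in nhds x. A x \<le> A z"
    and AR_le: "AR x \<le> A x"
    and AR_eq: "good x \<Longrightarrow> AR x = A x"
    and local_min_good: "\<And>\<phi> L \<delta> x. \<lbrakk>x \<in> S; \<delta> > 0; \<And>z. z \<in> S \<inter> cball x \<delta> \<Longrightarrow> \<phi> x + AR x \<le> \<phi> z + AR z;
        \<And>x z. x \<in> S \<Longrightarrow> z \<in> S \<Longrightarrow> \<phi> z - \<phi> x \<le> L * l1_dist x z; 0 \<le> L; L < Lcrit\<rbrakk> \<Longrightarrow> good x"
begin

lemma local_min_exact:
  assumes x: "x \<in> S" "\<delta> > 0" and min: "\<And>z. z \<in> S \<inter> cball x \<delta> \<Longrightarrow> \<phi> x + AR x \<le> \<phi> z + AR z"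
    and lip: "\<And>x z. x \<in> S \<Longrightarrow> z \<in> S \<Longrightarrow> \<phi> z - \<phi> x \<le> L * l1_dist x z" and L: "0 \<le> L" "L < Lcrit"
  shows "AR x = A x" and "z \<in> S \<inter> cball x \<delta> \<Longrightarrow> \<phi> x + A x \<le> \<phi> z + A z"
proof -
  show eq: "AR x = A x" by (rule AR_eq[OF local_min_good[where \<phi> = \<phi>, OF x min lip L]])
  show "\<phi> x + A x \<le> \<phi> z + A z" if "z \<in> S \<inter> cball x \<delta>"
    using min[OF that] AR_le[of z] eq by simp
qed

lemma global_min_good:
  assumes "x \<in> S" "\<forall>z\<in>S. \<phi> x + AR x \<le> \<phi> z + AR z"
    and "\<And>x z. x \<in> S \<Longrightarrow> z \<in> S \<Longrightarrow> \<phi> z - \<phi> x \<le> L * l1_dist x z" and "0 \<le> L" "L < Lcrit"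
  shows "good x"
  by (rule local_min_good[where \<phi> = \<phi> and \<delta> = 1, OF assms(1) _ _ assms(3-5)]) (use assms(2) in auto)

text \<open>For the converse direction, compare with a minimizer \<open>m\<close> of the relaxation, which exists by
  compactness. Since \<open>AR m = A m\<close>, the original minimum \<open>\<phi> x + A x\<close> is at most the relaxed one.\<close>

lemma global_minimizer_iff:
  assumes x: "x \<in> S"
    and lip: "\<And>x z. x \<in> S \<Longrightarrow> z \<in> S \<Longrightarrow> \<phi> z - \<phi> x \<le> L * l1_dist x z" and L: "0 \<le> L" "L < Lcrit"
  shows "(\<forall>z\<in>S. \<phi> x + A x \<le> \<phi> z + A z) \<longleftrightarrow> (\<forall>z\<in>S. \<phi> x + AR x \<le> \<phi> z + AR z)"
proof
  assume "\<forall>z\<in>S. \<phi> x + AR x \<le> \<phi> z + AR z"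
  then have "AR x = A x" by (intro AR_eq global_min_good[OF x _ lip L]) auto
  then show "\<forall>z\<in>S. \<phi> x + A x \<le> \<phi> z + A z"
    using \<open>\<forall>z\<in>S. \<phi> x + AR x \<le> \<phi> z + AR z\<close> AR_le by (metis add_left_mono order_trans)
next
  assume A: "\<forall>z\<in>S. \<phi> x + A x \<le> \<phi> z + A z"
  have "continuous_on S (\<lambda>z. \<phi> z + AR z)"
    by (intro continuous_intros continuous_AR l1_lipschitz_imp_continuous_on[OF lip])
  then obtain m where m: "m \<in> S" "\<forall>z\<in>S. \<phi> m + AR m \<le> \<phi> z + AR z"
    using continuous_attains_inf[OF compact_S, of "\<lambda>z. \<phi> z + AR z"] x by blast
  have "AR m = A m" by (rule AR_eq[OF global_min_good[OF m lip L]])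
  then have "\<phi> x + AR x \<le> \<phi> m + AR m" using A m(1) AR_le[of x] by fastforce
  then show "\<forall>z\<in>S. \<phi> x + AR x \<le> \<phi> z + AR z" using m(2) by (meson order_trans)
qed

lemma ex_maximum_diff:
  assumes T: "compact T" "T \<noteq> {}" and cont: "continuous_on T \<phi>"
  shows "\<exists>M. is_maximum (\<lambda>y. \<phi> y - A y) T M" and "\<exists>M. is_maximum (\<lambda>y. \<phi> y - AR y) T M"
proof -
  show "\<exists>M. is_maximum (\<lambda>y. \<phi> y - A y) T M"
  proof (rule usc_attains_max[OF T])
    fix y s assume y: "y \<in> T" "\<phi> y - A y < s"
    have "(\<phi> \<longlongrightarrow> \<phi> y) (at y within T)" using cont y(1) unfolding continuous_on_def by blast
    then have "\<forall>\<^sub>F z in at y within T. \<phi> z < s + A y" by (rule order_tendstoD(2)) (use y in simp)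
    moreover have "\<forall>\<^sub>F z in at y within T. A y \<le> A z"
      using filter_leD[OF at_within_le_nhds A_lsc] .
    ultimately show "\<forall>\<^sub>F z in at y within T. \<phi> z - A z < s" by eventually_elim simp
  qed
  have "continuous_on T (\<lambda>y. \<phi> y - AR y)" by (intro continuous_intros continuous_AR cont)
  from continuous_attains_sup[OF T this] show "\<exists>M. is_maximum (\<lambda>y. \<phi> y - AR y) T M"
    unfolding is_maximum_def by blast
qed

end

section \<open>Saddle points and minimax points\<close>

locale exact_minimax =
  X: exact_relaxation X A AR goodx Lx + Y: exact_relaxation Y B BR goody Ly
  for X :: "(real^'n) set" and A AR goodx Lx and Y :: "(real^'m) set" and B BR goody Ly +
  fixes c :: "real^'n \<Rightarrow> real^'m \<Rightarrow> real" and L :: real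
  assumes c_lip_x: "\<And>x z y. x \<in> X \<Longrightarrow> z \<in> X \<Longrightarrow> y \<in> Y \<Longrightarrow> c z y - c x y \<le> L * l1_dist x z"
    and c_lip_y: "\<And>x y z. x \<in> X \<Longrightarrow> y \<in> Y \<Longrightarrow> z \<in> Y \<Longrightarrow> c x z - c x y \<le> L * l1_dist y z"
    and L: "0 \<le> L" "L < Lx" "L < Ly"
begin

abbreviation F where "F x y \<equiv> c x y + A x - B y"
abbreviation FR where "FR x y \<equiv> c x y + AR x - BR y"

lemma neg_c_lip_y:
  assumes "x \<in> X" "y \<in> Y" "z \<in> Y"
  shows "- c x z - - c x y \<le> L * l1_dist y z"
proof -
  have "c x y - c x z \<le> L * l1_dist z y" by (rule c_lip_y[OF assms(1,3,2)])
  then show ?thesis unfolding l1_dist_commute[of z y] by linarith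
qed

lemma minimizer_in_x_iff:
  assumes "x \<in> X" "y \<in> Y"
  shows "(\<forall>z\<in>X. F x y \<le> F z y) \<longleftrightarrow> (\<forall>z\<in>X. FR x y \<le> FR z y)"
proof -
  have "(\<forall>z\<in>X. c x y + A x \<le> c z y + A z) \<longleftrightarrow> (\<forall>z\<in>X. c x y + AR x \<le> c z y + AR z)"
    by (rule X.global_minimizer_iff[where \<phi> = "\<lambda>z. c z y", OF assms(1) c_lip_x[OF _ _ assms(2)] L(1,2)])
  then show ?thesis by simp
qed

lemma maximizer_in_y_iff:
  assumes "x \<in> X" "y \<in> Y"
  shows "(\<forall>z\<in>Y. F x z \<le> F x y) \<longleftrightarrow> (\<forall>z\<in>Y. FR x z \<le> FR x y)"
proof -
  have "(\<forall>z\<in>Y. - c x y + B y \<le> - c x z + B z) \<longleftrightarrow> (\<forall>z\<in>Y. - c x y + BR y \<le> - c x z + BR z)"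
    by (rule Y.global_minimizer_iff[where \<phi> = "\<lambda>z. - c x z", OF assms(2) neg_c_lip_y[OF assms(1)] L(1,3)])
  moreover have "- p + q \<le> - r + s \<longleftrightarrow> r + a - s \<le> p + a - q" for p q r s a :: real by linarith
  ultimately show ?thesis by blast
qed

lemma saddle_point_iff: "saddle_point X Y F xs ys \<longleftrightarrow> saddle_point X Y FR xs ys"
proof (cases "xs \<in> X \<and> ys \<in> Y")
  case True
  then have mem: "xs \<in> X" "ys \<in> Y" by auto
  then have eq: "saddle_point X Y G xs ys \<longleftrightarrow> (\<forall>y\<in>Y. G xs y \<le> G xs ys) \<and> (\<forall>x\<in>X. G xs ys \<le> G x ys)"
    for G :: "real^'n \<Rightarrow> real^'m \<Rightarrow> real"
    unfolding saddle_point_def by blast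
  show ?thesis
    unfolding eq minimizer_in_x_iff[OF mem] maximizer_in_y_iff[OF mem] ..
qed (auto simp: saddle_point_def)

text \<open>The Lipschitz bound of \<open>c\<close> passes to the value function of the inner problem, because a maximizer
  for \<open>z\<close> is admissible for \<open>x\<close>.\<close>

lemma value_function:
  assumes T: "compact T" "T \<subseteq> Y" "T \<noteq> {}"
  obtains V where "\<And>x. x \<in> X \<Longrightarrow> is_maximum (\<lambda>y. c x y - BR y) T (V x)"
    and "\<And>x z. x \<in> X \<Longrightarrow> z \<in> X \<Longrightarrow> V z - V x \<le> L * l1_dist x z"
proof -
  have "\<exists>M. is_maximum (\<lambda>y. c x y - BR y) T M" if "x \<in> X" for x
    using T c_lip_y[OF that]
    by (intro Y.ex_maximum_diff(2) l1_lipschitz_imp_continuous_on[where L = L]) auto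
  then obtain V where V: "\<And>x. x \<in> X \<Longrightarrow> is_maximum (\<lambda>y. c x y - BR y) T (V x)" by metis
  have "V z - V x \<le> L * l1_dist x z" if xz: "x \<in> X" "z \<in> X" for x z
  proof -
    obtain y where y: "y \<in> T" "V z = c z y - BR y" using V[OF xz(2)] unfolding is_maximum_def by blast
    have "c x y - BR y \<le> V x" using V[OF xz(1)] y(1) unfolding is_maximum_def by blast
    then show ?thesis using c_lip_x[OF xz, of y] y T(2) by auto
  qed
  with V show ?thesis by (rule that)
qed

text \<open>A relaxed maximizer over all of \<open>Y\<close> is good, so relaxing the inner problem does not change its
  value.\<close>

lemma value_function_exact:
  assumes x: "x \<in> X" and M: "is_maximum (\<lambda>y. c x y - BR y) Y M"
  shows "is_maximum (\<lambda>y. c x y - B y) Y M"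
proof -
  obtain y where y: "y \<in> Y" "M = c x y - BR y" "\<forall>z\<in>Y. c x z - BR z \<le> M"
    using M unfolding is_maximum_def by blast
  have "BR y = B y"
    using y by (intro Y.AR_eq Y.global_min_good[OF y(1) _ neg_c_lip_y[OF x] L(1,3)]) auto
  moreover have "\<forall>z\<in>Y. c x z - B z \<le> M" using y(3) Y.AR_le by (meson diff_left_mono order_trans)
  ultimately show ?thesis using y unfolding is_maximum_def by auto
qed

lemma is_maximum_shift:
  "is_maximum (\<lambda>y. \<phi> y + a - \<beta> y) T (M + a) \<longleftrightarrow> is_maximum (\<lambda>y. \<phi> y - \<beta> y) T (M::real)"
proof -
  have "M + a = \<phi> y + a - \<beta> y \<longleftrightarrow> M = \<phi> y - \<beta> y" "\<phi> y + a - \<beta> y \<le> M + a \<longleftrightarrow> \<phi> y - \<beta> y \<le> M" for y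
    by auto
  then show ?thesis unfolding is_maximum_def image_iff by simp
qed

lemma is_maximum_unique: "is_maximum \<phi> T M \<Longrightarrow> is_maximum \<phi> T (N::real) \<Longrightarrow> M = N"
  unfolding is_maximum_def by (auto intro: antisym)

text \<open>With the common value function \<open>V\<close>, the outer conditions say that \<open>xs\<close> minimizes \<open>V + A\<close> and
  \<open>V + AR\<close>, respectively, so \<open>global_minimizer_iff\<close> applies to \<open>V\<close>.\<close>

lemma global_minimax_point_iff: "global_minimax_point X Y F xs ys \<longleftrightarrow> global_minimax_point X Y FR xs ys"
proof (cases "xs \<in> X \<and> ys \<in> Y")
  case True
  then obtain V where V: "\<And>x. x \<in> X \<Longrightarrow> is_maximum (\<lambda>y. c x y - BR y) Y (V x)"
      "\<And>x z. x \<in> X \<Longrightarrow> z \<in> X \<Longrightarrow> V z - V x \<le> L * l1_dist x z"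
    using value_function[of Y] Y.compact_S by blast
  have mFR: "is_maximum (FR x) Y (V x + AR x)" if "x \<in> X" for x
    unfolding is_maximum_shift by (rule V(1)[OF that])
  have mF: "is_maximum (F x) Y (V x + A x)" if "x \<in> X" for x
    unfolding is_maximum_shift by (rule value_function_exact[OF that V(1)[OF that]])
  have char: "global_minimax_point X Y G xs ys \<longleftrightarrow>
      (\<forall>y\<in>Y. G xs y \<le> G xs ys) \<and> (\<forall>x\<in>X. V xs + W xs \<le> V x + W x)"
    if G: "\<And>x. x \<in> X \<Longrightarrow> is_maximum (G x) Y (V x + W x)" for G :: "_ \<Rightarrow> _ \<Rightarrow> real" and W
  proof -
    have "(\<exists>M. is_maximum (G x) Y M \<and> G xs ys \<le> M) \<longleftrightarrow> G xs ys \<le> V x + W x" if "x \<in> X" for x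
      using G[OF that] is_maximum_unique by metis
    moreover have "G xs ys = V xs + W xs" if "\<forall>y\<in>Y. G xs y \<le> G xs ys"
    proof (rule is_maximum_unique)
      show "is_maximum (G xs) Y (G xs ys)" using True that unfolding is_maximum_def by simp
    qed (use G True in blast)
    ultimately show ?thesis unfolding global_minimax_point_def using True by auto
  qed
  have mem: "xs \<in> X" "ys \<in> Y" using True by auto
  have "global_minimax_point X Y F xs ys \<longleftrightarrow>
      (\<forall>y\<in>Y. F xs y \<le> F xs ys) \<and> (\<forall>x\<in>X. V xs + A xs \<le> V x + A x)"
    by (rule char) (rule mF)
  moreover have "global_minimax_point X Y FR xs ys \<longleftrightarrow>
      (\<forall>y\<in>Y. FR xs y \<le> FR xs ys) \<and> (\<forall>x\<in>X. V xs + AR xs \<le> V x + AR x)"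
    by (rule char) (rule mFR)
  moreover have "(\<forall>x\<in>X. V xs + A xs \<le> V x + A x) \<longleftrightarrow> (\<forall>x\<in>X. V xs + AR xs \<le> V x + AR x)"
    by (rule X.global_minimizer_iff[OF mem(1) V(2) L(1,2)])
  ultimately show ?thesis using maximizer_in_y_iff[OF mem] by argo
qed (auto simp: global_minimax_point_def)

lemma local_saddle_point_exact:
  assumes "local_saddle_point X Y FR xs ys"
  shows "local_saddle_point X Y F xs ys \<and> goodx xs \<and> goody ys"
proof -
  obtain \<delta> where mem: "xs \<in> X" "ys \<in> Y" and \<delta>: "\<delta> > 0"
    and H: "\<And>x y. x \<in> X \<inter> cball xs \<delta> \<Longrightarrow> y \<in> Y \<inter> cball ys \<delta> \<Longrightarrow> FR xs y \<le> FR xs ys \<and> FR xs ys \<le> FR x ys"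
    using assms unfolding local_saddle_point_def by blast
  have minx: "c xs ys + AR xs \<le> c z ys + AR z" if "z \<in> X \<inter> cball xs \<delta>" for z
    using H[OF that, of ys] mem \<delta> by simp
  have miny: "- c xs ys + BR ys \<le> - c xs z + BR z" if "z \<in> Y \<inter> cball ys \<delta>" for z
    using H[OF _ that, of xs] mem \<delta> by simp
  have "goodx xs"
    by (rule X.local_min_good[where \<phi> = "\<lambda>z. c z ys", OF mem(1) \<delta> minx c_lip_x[OF _ _ mem(2)] L(1,2)])
  moreover have "goody ys"
    by (rule Y.local_min_good[where \<phi> = "\<lambda>z. - c xs z", OF mem(2) \<delta> miny neg_c_lip_y[OF mem(1)] L(1,3)])
  moreover have "F xs ys \<le> F z ys" if "z \<in> X \<inter> cball xs \<delta>" for z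
    using X.local_min_exact(2)[where \<phi> = "\<lambda>z. c z ys", OF mem(1) \<delta> minx c_lip_x[OF _ _ mem(2)] L(1,2) that]
    by simp
  moreover have "F xs z \<le> F xs ys" if "z \<in> Y \<inter> cball ys \<delta>" for z
    using Y.local_min_exact(2)[where \<phi> = "\<lambda>z. - c xs z", OF mem(2) \<delta> miny neg_c_lip_y[OF mem(1)] L(1,3) that]
    by simp
  ultimately show ?thesis unfolding local_saddle_point_def using mem \<delta> by blast
qed

text \<open>A penalized ascent in the spirit of Ekeland's principle: maximize
  \<open>c x y - BR y - \<kappa> * l1_dist yh y\<close> over a ball around \<open>y0\<close>. The penalty forces the maximizer to
  lie close enough to \<open>yh\<close> to be in the open ball, hence to be a local maximizer on \<open>Y\<close> and good, since
  \<open>L + \<kappa>\<close> is still below the threshold.\<close>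

lemma exact_ascent_point:
  assumes x: "x \<in> X" and y0: "y0 \<in> Y" and yh: "yh \<in> Y" and \<kappa>: "0 < \<kappa>" "L + \<kappa> < Ly"
    and G: "0 \<le> G" and near: "dist y0 yh + G / \<kappa> < \<delta>"
    and gain: "\<And>y. y \<in> Y \<inter> cball y0 \<delta> \<Longrightarrow> (c x y - BR y) - (c x yh - BR yh) \<le> G"
  obtains y where "y \<in> Y" "dist y0 y \<le> dist y0 yh + G / \<kappa>" "c x yh - BR yh \<le> c x y - B y"
proof -
  let ?T = "Y \<inter> cball y0 \<delta>"
  let ?\<phi> = "\<lambda>y. - c x y + \<kappa> * l1_dist yh y"
  have lip: "?\<phi> z - ?\<phi> y \<le> (L + \<kappa>) * l1_dist y z" if "y \<in> Y" "z \<in> Y" for y z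
  proof -
    have "\<kappa> * l1_dist yh z \<le> \<kappa> * (l1_dist yh y + l1_dist y z)"
      using \<kappa>(1) by (intro mult_left_mono l1_dist_triangle) auto
    then show ?thesis using neg_c_lip_y[OF x that] by (simp add: algebra_simps)
  qed
  have "0 \<le> G / \<kappa>" using G \<kappa>(1) by simp
  then have "dist y0 yh \<le> \<delta>" using near by simp
  have "continuous_on Y (\<lambda>y. ?\<phi> y + BR y)"
    by (intro continuous_on_add[of Y ?\<phi>] Y.continuous_AR l1_lipschitz_imp_continuous_on[of Y ?\<phi> "L + \<kappa>"] lip)
  then have cont: "continuous_on ?T (\<lambda>y. ?\<phi> y + BR y)" by (rule continuous_on_subset) auto
  have "compact ?T" "yh \<in> ?T" using Y.compact_S yh \<open>dist y0 yh \<le> \<delta>\<close> by (auto intro: compact_Int)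
  then obtain y where y: "y \<in> ?T" and min: "\<forall>z\<in>?T. ?\<phi> y + BR y \<le> ?\<phi> z + BR z"
    using continuous_attains_inf[OF _ _ cont] by blast
  have pen: "\<kappa> * l1_dist yh y \<le> (c x y - BR y) - (c x yh - BR yh)"
    using bspec[OF min \<open>yh \<in> ?T\<close>] by simp
  also have "\<dots> \<le> G" by (rule gain[OF y])
  finally have "l1_dist yh y \<le> G / \<kappa>" using \<kappa>(1) by (simp add: pos_le_divide_eq mult.commute)
  then have dist: "dist y0 y \<le> dist y0 yh + G / \<kappa>"
    using dist_triangle[of y0 y yh] dist_le_l1_dist[of yh y] by linarith
  have "goody y"
  proof (rule Y.local_min_good[where \<phi> = ?\<phi> and L = "L + \<kappa>" and \<delta> = "\<delta> - dist y0 y"])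
    show "y \<in> Y" using y by simp
    show "\<delta> - dist y0 y > 0" using dist near by simp
    show "?\<phi> y + BR y \<le> ?\<phi> z + BR z" if "z \<in> Y \<inter> cball y (\<delta> - dist y0 y)" for z
    proof -
      have "z \<in> ?T" using that dist_triangle[of y0 z y] by auto
      then show ?thesis using min by blast
    qed
  qed (use lip L \<kappa> in auto)
  then have "BR y = B y" by (rule Y.AR_eq)
  moreover have "c x yh - BR yh \<le> c x y - BR y"
  proof -
    have "0 \<le> \<kappa> * l1_dist yh y" using \<kappa>(1) by simp
    then show ?thesis using pen by linarith
  qed
  ultimately show ?thesis using that[of y] y dist by simp
qed

text \<open>To see that \<open>xs\<close> is good, fix one \<open>\<delta>\<close> with \<open>\<pi> \<delta> < \<delta>0\<close>. The value function
  \<open>V\<close> of the inner problem over the ball of radius \<open>\<pi> \<delta>\<close> then satisfies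
  \<open>V xs + AR xs \<le> FR xs ys\<close>, because \<open>ys\<close> is a maximizer on the larger ball, so \<open>xs\<close> is a local minimizer of
  \<open>V + AR\<close>. For nearby \<open>x\<close>, \<open>exact_ascent_point\<close> moves the relaxed inner maximizer to a point where the
  original objective is at least \<open>F xs ys\<close>.\<close>

lemma local_minimax_point_exact:
  assumes "local_minimax_point X Y FR xs ys"
  shows "local_minimax_point X Y F xs ys"
proof -
  obtain \<delta>0 \<pi> where mem: "xs \<in> X" "ys \<in> Y" and \<delta>0: "\<delta>0 > 0"
    and \<pi>_nonneg: "\<And>\<delta>. \<delta> \<ge> 0 \<Longrightarrow> \<pi> \<delta> \<ge> 0" and \<pi>_lim: "(\<pi> \<longlongrightarrow> 0) (at_right 0)"
    and H: "\<And>\<delta> x y. \<delta> \<in> {0<..\<delta>0} \<Longrightarrow> x \<in> X \<inter> cball xs \<delta> \<Longrightarrow> y \<in> Y \<inter> cball ys \<delta> \<Longrightarrow>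
           FR xs y \<le> FR xs ys \<and> (\<exists>M. is_maximum (FR x) (Y \<inter> cball ys (\<pi> \<delta>)) M \<and> FR xs ys \<le> M)"
    using assms unfolding local_minimax_point_def by (smt (verit))
  have maxy: "FR xs y \<le> FR xs ys" if "y \<in> Y \<inter> cball ys \<delta>0" for y
    using H[of \<delta>0 xs y] that \<delta>0 mem by simp
  have maxx: "\<exists>M. is_maximum (FR x) (Y \<inter> cball ys (\<pi> \<delta>)) M \<and> FR xs ys \<le> M"
    if "\<delta> \<in> {0<..\<delta>0}" "x \<in> X \<inter> cball xs \<delta>" for \<delta> x
    using H[OF that, of ys] mem(2) that by simp
  have miny: "- c xs ys + BR ys \<le> - c xs z + BR z" if "z \<in> Y \<inter> cball ys \<delta>0" for z
    using maxy[OF that] by simp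
  have By: "BR ys = B ys"
    by (rule Y.local_min_exact(1)[where \<phi> = "\<lambda>z. - c xs z", OF mem(2) \<delta>0 miny neg_c_lip_y[OF mem(1)] L(1,3)])
  have Fmaxy: "F xs y \<le> F xs ys" if "y \<in> Y \<inter> cball ys \<delta>0" for y
    using Y.local_min_exact(2)[where \<phi> = "\<lambda>z. - c xs z", OF mem(2) \<delta>0 miny neg_c_lip_y[OF mem(1)] L(1,3) that]
    by simp

  have Ax: "AR xs = A xs"
  proof -
    have "\<forall>\<^sub>F \<delta> in at_right 0. \<pi> \<delta> < \<delta>0" by (rule order_tendstoD(2)[OF \<pi>_lim \<delta>0])
    moreover have "\<forall>\<^sub>F \<delta> in at_right 0. \<delta> \<in> {0<..<\<delta>0}" by (rule eventually_at_right_real[OF \<delta>0])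
    ultimately have "\<forall>\<^sub>F \<delta> in at_right 0. \<pi> \<delta> < \<delta>0 \<and> \<delta> \<in> {0<..<\<delta>0}" by eventually_elim simp
    then obtain \<delta> where \<delta>: "\<pi> \<delta> < \<delta>0" "0 < \<delta>" "\<delta> < \<delta>0"
      using eventually_happens'[OF trivial_limit_at_right_real] by auto
    let ?T = "Y \<inter> cball ys (\<pi> \<delta>)"
    have T: "compact ?T" "?T \<subseteq> Y" "?T \<noteq> {}"
      using Y.compact_S mem \<pi>_nonneg[of \<delta>] \<delta> by (auto intro: compact_Int)
    obtain V where V: "\<And>x. x \<in> X \<Longrightarrow> is_maximum (\<lambda>y. c x y - BR y) ?T (V x)"
      "\<And>x z. x \<in> X \<Longrightarrow> z \<in> X \<Longrightarrow> V z - V x \<le> L * l1_dist x z"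
      using value_function[OF T] by blast
    have "V xs + AR xs \<le> V x + AR x" if x: "x \<in> X \<inter> cball xs \<delta>" for x
    proof -
      obtain y where y: "y \<in> ?T" "V xs = c xs y - BR y"
        using V(1)[OF mem(1)] unfolding is_maximum_def by blast
      have "y \<in> Y \<inter> cball ys \<delta>0" using y(1) \<delta> by auto
      then have "V xs + AR xs \<le> FR xs ys" using maxy[of y] y(2) by simp
      moreover obtain M where M: "is_maximum (FR x) ?T M" "FR xs ys \<le> M"
        using maxx[OF _ x] \<delta> by auto
      moreover have "is_maximum (FR x) ?T (V x + AR x)"
        unfolding is_maximum_shift using V(1)[of x] x by blast
      ultimately show ?thesis using is_maximum_unique by fastforce
    qed
    then show ?thesis
      using X.local_min_exact(1)[where \<phi> = V, OF mem(1) \<delta>(2) _ V(2) L(1,2)] by blast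
  qed

  \<comment> \<open>Any penalty weight with \<open>0 < \<kappa> < Ly - L\<close> would do.\<close>
  define \<kappa> where "\<kappa> = (Ly - L) / 2"
  have \<kappa>: "0 < \<kappa>" "L + \<kappa> < Ly" using L by (auto simp: \<kappa>_def field_simps)
  \<comment> \<open>This bounds \<open>FR x y - FR xs y\<close> for all \<open>y\<close>, hence the gain available to the penalized ascent.\<close>
  let ?\<psi> = "\<lambda>x. L * l1_dist xs x + \<bar>AR x - AR xs\<bar>"
  have "continuous_on X ?\<psi>"
    by (intro continuous_intros X.continuous_AR)
  then obtain \<omega> where \<omega>_nonneg: "\<And>\<delta>. \<delta> \<ge> 0 \<Longrightarrow> \<omega> \<delta> \<ge> 0" and \<omega>_lim: "(\<omega> \<longlongrightarrow> 0) (at_right 0)"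
    and \<omega>: "\<And>\<delta> x. x \<in> X \<inter> cball xs \<delta> \<Longrightarrow> ?\<psi> x \<le> \<omega> \<delta>"
    using modulus_at_point[OF X.compact_S, of ?\<psi> xs] mem(1) L(1) by auto
  define \<pi>' where "\<pi>' \<delta> = \<pi> \<delta> + \<omega> \<delta> / \<kappa>" for \<delta>
  have \<pi>'_nonneg: "\<forall>\<delta>\<ge>0. \<pi>' \<delta> \<ge> 0" using \<pi>_nonneg \<omega>_nonneg \<kappa>(1) by (simp add: \<pi>'_def)
  have "(\<pi>' \<longlongrightarrow> 0 + 0 / \<kappa>) (at_right 0)"
    unfolding \<pi>'_def[abs_def] using \<kappa>(1) by (intro tendsto_intros \<pi>_lim \<omega>_lim) simp
  then have \<pi>'_lim: "(\<pi>' \<longlongrightarrow> 0) (at_right 0)" by simp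
  \<comment> \<open>Below \<open>b\<close> the new radius stays inside the ball on which \<open>ys\<close> is known to be a maximizer.\<close>
  obtain b where b: "b > 0" "\<And>\<delta>. 0 < \<delta> \<Longrightarrow> \<delta> < b \<Longrightarrow> \<pi>' \<delta> < \<delta>0"
    using order_tendstoD(2)[OF \<pi>'_lim \<delta>0] unfolding eventually_at_right_field by auto
  define \<delta>1 where "\<delta>1 = min \<delta>0 (b / 2)"
  have \<delta>1: "\<delta>1 > 0" "\<delta>1 \<le> \<delta>0" "\<delta>1 < b" using \<delta>0 b(1) by (auto simp: \<delta>1_def)

  have "\<exists>M. is_maximum (F x) (Y \<inter> cball ys (\<pi>' \<delta>)) M \<and> F xs ys \<le> M"
    if \<delta>: "\<delta> \<in> {0<..\<delta>1}" and x: "x \<in> X \<inter> cball xs \<delta>" for \<delta> x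
  proof -
    have "\<delta> \<in> {0<..\<delta>0}" using \<delta> \<delta>1 by auto
    from maxx[OF this x] obtain yh where yh: "yh \<in> Y" "dist ys yh \<le> \<pi> \<delta>" "FR xs ys \<le> FR x yh"
      unfolding is_maximum_def by auto
    have gain: "(c x y - BR y) - (c x yh - BR yh) \<le> \<omega> \<delta>" if y: "y \<in> Y \<inter> cball ys \<delta>0" for y
    proof -
      have "c x y - c xs y \<le> L * l1_dist xs x" using c_lip_x[of xs x y] mem x y by auto
      then show ?thesis using \<omega>[OF x] maxy[OF y] yh(3) by (auto simp: abs_le_iff)
    qed
    have "\<pi>' \<delta> < \<delta>0" using b(2)[of \<delta>] \<delta> \<delta>1 by auto
    then have near: "dist ys yh + \<omega> \<delta> / \<kappa> < \<delta>0" using yh(2) by (simp add: \<pi>'_def)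
    obtain y where y: "y \<in> Y" "dist ys y \<le> dist ys yh + \<omega> \<delta> / \<kappa>" "c x yh - BR yh \<le> c x y - B y"
      using exact_ascent_point[OF _ mem(2) yh(1) \<kappa> \<omega>_nonneg near gain] x \<delta> by auto
    have T: "y \<in> Y \<inter> cball ys (\<pi>' \<delta>)" using y yh(2) by (simp add: \<pi>'_def)
    have "F xs ys \<le> F x y" using y(3) yh(3) Ax By X.AR_le[of x] by simp
    moreover have "\<exists>M. is_maximum (\<lambda>y. c x y - B y) (Y \<inter> cball ys (\<pi>' \<delta>)) M"
      using T x Y.compact_S
      by (intro Y.ex_maximum_diff(1) l1_lipschitz_imp_continuous_on[where L = L] c_lip_y) (auto intro: compact_Int)
    then obtain M where "is_maximum (F x) (Y \<inter> cball ys (\<pi>' \<delta>)) (M + A x)"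
      unfolding is_maximum_shift by blast
    ultimately show ?thesis using T unfolding is_maximum_def by (meson order_trans)
  qed
  moreover have "F xs y \<le> F xs ys" if "\<delta> \<in> {0<..\<delta>1}" "y \<in> Y \<inter> cball ys \<delta>" for \<delta> y
    using Fmaxy[of y] that \<delta>1 by auto
  ultimately show ?thesis
    unfolding local_minimax_point_def using mem \<delta>1(1) \<pi>'_nonneg \<pi>'_lim by blast
qed

end

context relaxed_block
begin

lemma pos_zero_power_lsc: "\<forall>\<^sub>F z in nhds x. pos_zero_power (g p (x $ i)) \<le> pos_zero_power (g p (z $ i))"
proof (cases "g p (x $ i) > 0")
  case True
  have "isCont (\<lambda>z. g p (z $ i)) x"
    by (rule isCont_o2[OF _ continuous_g]) (intro continuous_intros)
  then have "((\<lambda>z. g p (z $ i)) \<longlongrightarrow> g p (x $ i)) (nhds x)"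
    by (simp add: isCont_def tendsto_nhds_iff)
  then have "\<forall>\<^sub>F z in nhds x. g p (z $ i) > 0" using True by (rule order_tendstoD(1))
  then show ?thesis by eventually_elim (simp add: pos_zero_power_def)
qed (simp add: pos_zero_power_def)

lemma exact_relaxation_counts:
  assumes lam: "lam > 0"
  shows "exact_relaxation K (\<lambda>x. lam * step_count g x) (\<lambda>x. lam * smoothed_count \<rho> \<mu> g x)
           (off_band (\<alpha> * \<mu>) g) (lam * \<sigma> * rlo / \<mu>)"
proof
  show "compact K" by (rule compact_K)
next
  fix T :: "(real^'d) set"
  have "continuous_on T (\<lambda>x. r (g p (x $ i)))" for p i
  proof (rule continuous_on_compose2[OF continuous_on_step[of UNIV]])
    show "continuous_on T (\<lambda>x. g p (x $ i))"
    proof (rule continuous_on_compose2[of UNIV "g p"])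
      show "continuous_on UNIV (g p)" by (simp add: continuous_at_imp_continuous_on continuous_g)
    qed (auto intro: continuous_intros)
  qed auto
  then show "continuous_on T (\<lambda>x. lam * smoothed_count \<rho> \<mu> g x)"
    unfolding smoothed_count_def by (intro continuous_intros)
next
  fix x :: "real^'d"
  have "\<forall>\<^sub>F z in nhds x. \<forall>i\<in>UNIV. pos_zero_power (g (Inl i) (x $ i)) \<le> pos_zero_power (g (Inl i) (z $ i))
      \<and> pos_zero_power (g (Inr i) (x $ i)) \<le> pos_zero_power (g (Inr i) (z $ i))"
    by (intro eventually_ball_finite ballI eventually_conj pos_zero_power_lsc) simp
  then show "\<forall>\<^sub>F z in nhds x. lam * step_count g x \<le> lam * step_count g z"
  proof eventually_elim
    case (elim z)
    then show ?case
      unfolding step_count_def using lam by (intro mult_left_mono sum_mono add_mono) auto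
  qed
next
  fix x :: "real^'d"
  show "lam * smoothed_count \<rho> \<mu> g x \<le> lam * step_count g x"
    unfolding step_count_def smoothed_count_def
    using lam by (intro mult_left_mono sum_mono add_mono step_le_pos_zero_power) auto
next
  fix x :: "real^'d"
  assume "off_band (\<alpha> * \<mu>) g x"
  then show "lam * smoothed_count \<rho> \<mu> g x = lam * step_count g x"
    unfolding off_band_def step_count_def smoothed_count_def by (simp add: step_eq_pos_zero_power)
next
  fix \<phi> :: "real^'d \<Rightarrow> real" and L \<delta> x
  assume "x \<in> K" "\<delta> > 0"
    and "\<And>z. z \<in> K \<inter> cball x \<delta> \<Longrightarrow> \<phi> x + lam * smoothed_count \<rho> \<mu> g x \<le> \<phi> z + lam * smoothed_count \<rho> \<mu> g z"
    and "\<And>x z. x \<in> K \<Longrightarrow> z \<in> K \<Longrightarrow> \<phi> z - \<phi> x \<le> L * l1_dist x z"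
    and "0 \<le> L" "L < lam * \<sigma> * rlo / \<mu>"
  then show "off_band (\<alpha> * \<mu>) g x"
    using lam by (intro local_min_off_band[where \<phi> = \<phi> and L = L and lam = lam and \<delta> = \<delta>]) auto
qed

end


section \<open>Exactness of the relaxation\<close>

theorem theorem5p1:
  fixes c :: "real^'n \<Rightarrow> real^'m \<Rightarrow> real"
    and g :: "'n + 'n \<Rightarrow> real \<Rightarrow> real" and h :: "'m + 'm \<Rightarrow> real \<Rightarrow> real"
    and ulo uhi :: "real^'n" and vlo vhi :: "real^'m"
    and nbar mbar :: nat
    and u :: "nat \<Rightarrow> real^'n \<Rightarrow> real" and v :: "nat \<Rightarrow> real^'m \<Rightarrow> real"
    and X :: "(real^'n) set" and Y :: "(real^'m) set"
    and \<rho> :: "real \<Rightarrow> real"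
    and lam1 lam2 Lc \<tau> \<sigma> \<alpha> rlo rhi \<mu> :: real
    and f fR :: "real^'n \<Rightarrow> real^'m \<Rightarrow> real"
    and xs :: "real^'n" and ys :: "real^'m"
  assumes X_def: "X = feasible_set ulo uhi nbar u"
    and Y_def: "Y = feasible_set vlo vhi mbar v"
    and f_def: "f = objective c lam1 lam2 g h"
    and fR_def: "fR = relaxed_objective c lam1 lam2 g h \<rho> \<mu>"
    and c_lipschitz: "\<exists>L. L-lipschitz_on UNIV (\<lambda>(x, y). c x y)"
    and c_convex: "\<And>y. convex_on UNIV (\<lambda>x. c x y)"
    and c_concave: "\<And>x. concave_on UNIV (\<lambda>y. c x y)"
    and g_C1: "\<And>p. g p C1_differentiable_on UNIV"
    and h_C1: "\<And>q. h q C1_differentiable_on UNIV"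
    and lam_pos: "lam1 > 0" "lam2 > 0"
    and u_bounds: "\<And>i. ulo $ i < uhi $ i"
    and v_bounds: "\<And>j. vlo $ j < vhi $ j"
    and u_convex: "\<And>t. t \<in> {1..nbar} \<Longrightarrow> convex_on UNIV (u t)"
    and u_lipschitz: "\<And>t. t \<in> {1..nbar} \<Longrightarrow> \<exists>L. L-lipschitz_on UNIV (u t)"
    and v_convex: "\<And>s. s \<in> {1..mbar} \<Longrightarrow> convex_on UNIV (v s)"
    and v_lipschitz: "\<And>s. s \<in> {1..mbar} \<Longrightarrow> \<exists>L. L-lipschitz_on UNIV (v s)"
    and X_interior: "interior X \<noteq> {}"
    and Y_interior: "interior Y \<noteq> {}"
    and u_nondegenerate: "\<And>t. t \<in> {1..nbar} \<Longrightarrow> \<exists>x. u t x < 0"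
    and v_nondegenerate: "\<And>s. s \<in> {1..mbar} \<Longrightarrow> \<exists>y. v s y < 0"
    and Lc_pos: "Lc > 0"
    and Lc_x: "\<And>x y. x \<in> X \<Longrightarrow> y \<in> Y \<Longrightarrow> set_infnorm (clarke_subdiff (\<lambda>x'. c x' y) x) \<le> ereal Lc"
    and Lc_y: "\<And>x y. x \<in> X \<Longrightarrow> y \<in> Y \<Longrightarrow> set_infnorm (clarke_subdiff (\<lambda>y'. c x y') y) \<le> ereal Lc"
    and consts_pos: "\<tau> > 0" "\<sigma> > 0"
    and cond_A_i: "structural_condition ulo uhi nbar u g \<tau> \<sigma>"
    and cond_A_ii: "structural_condition vlo vhi mbar v h \<tau> \<sigma>"
    and alpha_pos: "\<alpha> > 0"
    and rho_pc: "piecewise_continuous \<rho>"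
    and rho_nonneg: "\<And>s. \<rho> s \<ge> 0"
    and rho_integral: "(\<rho> has_integral 1) UNIV"
    and rho_support: "\<And>s. s \<notin> {0..\<alpha>} \<Longrightarrow> \<rho> s = 0"
    and rho_bounds_pos: "rlo > 0" "rhi > 0"
    and rho_bounds: "\<And>s. s \<in> {0<..<\<alpha>} \<Longrightarrow> rlo \<le> \<rho> s \<and> \<rho> s \<le> rhi"
    and mu_pos: "\<mu> > 0"
    and mu_less: "\<mu> < min (\<tau> / \<alpha>) (min lam1 lam2 * \<sigma> * rlo / Lc)"
  shows "(saddle_point X Y f xs ys \<longleftrightarrow> saddle_point X Y fR xs ys) \<and>
         (global_minimax_point X Y f xs ys \<longleftrightarrow> global_minimax_point X Y fR xs ys) \<and>
         (local_saddle_point X Y fR xs ys \<longrightarrow>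
            strong_local_saddle_point (\<alpha> * \<mu>) X Y f g h xs ys) \<and>
         (local_minimax_point X Y fR xs ys \<longrightarrow> local_minimax_point X Y f xs ys)"
proof -
  have band: "\<alpha> * \<mu> < \<tau>" using mu_less alpha_pos by (simp add: pos_less_divide_eq mult.commute)
  have "\<mu> < min lam1 lam2 * \<sigma> * rlo / Lc" using mu_less by simp
  then have Lc_lt: "Lc < min lam1 lam2 * \<sigma> * rlo / \<mu>"
    using Lc_pos mu_pos by (simp add: pos_less_divide_eq mult.commute)
  have Lc_crit: "Lc < lam * \<sigma> * rlo / \<mu>" if "min lam1 lam2 \<le> lam" for lam
  proof (rule less_le_trans[OF Lc_lt])
    show "min lam1 lam2 * \<sigma> * rlo / \<mu> \<le> lam * \<sigma> * rlo / \<mu>"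
      using that consts_pos rho_bounds_pos mu_pos by (intro divide_right_mono mult_right_mono) auto
  qed
  have step: "step_density \<rho> \<alpha> rlo rhi \<mu>"
    using alpha_pos rho_nonneg rho_integral rho_support rho_bounds_pos rho_bounds mu_pos
    by unfold_locales auto
  have diff: "\<phi> differentiable at x" if "\<phi> C1_differentiable_on UNIV" for \<phi> :: "real \<Rightarrow> real" and x
    using that unfolding C1_differentiable_on_eq by simp
  have block_x: "relaxed_block \<rho> \<alpha> rlo rhi \<mu> ulo uhi nbar u g \<tau> \<sigma>"
    using step u_convex X_interior u_nondegenerate diff[OF g_C1] cond_A_i consts_pos band
    unfolding relaxed_block_def relaxed_block_axioms_def X_def by blast
  have block_y: "relaxed_block \<rho> \<alpha> rlo rhi \<mu> vlo vhi mbar v h \<tau> \<sigma>"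
    using step v_convex Y_interior v_nondegenerate diff[OF h_C1] cond_A_ii consts_pos band
    unfolding relaxed_block_def relaxed_block_axioms_def Y_def by blast
  interpret exact_minimax X "\<lambda>x. lam1 * step_count g x" "\<lambda>x. lam1 * smoothed_count \<rho> \<mu> g x"
      "off_band (\<alpha> * \<mu>) g" "lam1 * \<sigma> * rlo / \<mu>"
    Y "\<lambda>y. lam2 * step_count h y" "\<lambda>y. lam2 * smoothed_count \<rho> \<mu> h y"
      "off_band (\<alpha> * \<mu>) h" "lam2 * \<sigma> * rlo / \<mu>" c Lc
  proof (intro exact_minimax.intro exact_minimax_axioms.intro)
    show "exact_relaxation X (\<lambda>x. lam1 * step_count g x) (\<lambda>x. lam1 * smoothed_count \<rho> \<mu> g x)
        (off_band (\<alpha> * \<mu>) g) (lam1 * \<sigma> * rlo / \<mu>)"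
      unfolding X_def by (rule relaxed_block.exact_relaxation_counts[OF block_x lam_pos(1)])
    show "exact_relaxation Y (\<lambda>y. lam2 * step_count h y) (\<lambda>y. lam2 * smoothed_count \<rho> \<mu> h y)
        (off_band (\<alpha> * \<mu>) h) (lam2 * \<sigma> * rlo / \<mu>)"
      unfolding Y_def by (rule relaxed_block.exact_relaxation_counts[OF block_y lam_pos(2)])
    show "c z y - c x y \<le> Lc * l1_dist x z" if "x \<in> X" "z \<in> X" "y \<in> Y" for x z y
      by (rule convex_l1_lipschitz[OF c_convex Lc_x[OF that(2,3)]])
    show "c x z - c x y \<le> Lc * l1_dist y z" if "x \<in> X" "y \<in> Y" "z \<in> Y" for x y z
      unfolding l1_dist_commute[of y z]
      by (rule concave_l1_lipschitz[OF c_concave Lc_y[OF that(1,2)]])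
    show "0 \<le> Lc" "Lc < lam1 * \<sigma> * rlo / \<mu>" "Lc < lam2 * \<sigma> * rlo / \<mu>"
      using Lc_pos Lc_crit by auto
  qed
  have f: "f = F" and fR: "fR = FR"
    unfolding f_def fR_def objective_def relaxed_objective_def step_count_def smoothed_count_def
    by (auto simp: fun_eq_iff)
  have "strong_local_saddle_point (\<alpha> * \<mu>) X Y f g h xs ys" if "local_saddle_point X Y fR xs ys"
    using local_saddle_point_exact[OF that[unfolded fR]]
    unfolding strong_local_saddle_point_def off_band_def f by blast
  then show ?thesis
    using saddle_point_iff[of xs ys] global_minimax_point_iff[of xs ys] local_minimax_point_exact[of xs ys]
    unfolding f fR by blast
qed

end
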